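(* Let $n\ge3$. Consider $\mathcal{K}_3$ and $\mathcal{W}_n$ either both as plain semigroups, or both as involution semigroups with respect to the reflection ${}^*$. Then every variety $\mathbf{V}$ of semigroups (respectively, of involution semigroups) such that $\operatorname{var}\mathcal{K}_3\subseteq\mathbf{V}\subseteq\operatorname{var}\mathcal{W}_n$ is nonfinitely based.
   Context: For $n\ge2$, let $[n]=\{1,\dots,n\}$ and $[n]'=\{1',\dots,n'\}$. The wire monoid $\mathcal{W}_n$ has as elements all pairs $(\pi;d)$ where $\pi$ is a partition of $[n]\cup[n]'$ into 2-element blocks and $d\ge0$ is an integer. The product of $\xi=(\pi_1;d_1)$ and $\eta=(\pi_2;d_2)$ is defined as follows. Take a third disjoint copy $[n]''=\{1'',\dots,n''\}$ and form the multigraph $\Gamma$ on $[n]\cup[n]''\cup[n]'$ whose edges are: $\{\sigma(x),\sigma(y)\}$ for each block $\{x,y\}$ of $\pi_1$, where $\sigma$ fixes $[n]$ and sends $k'\mapsto k''$; and $\{\tau(x),\tau(y)\}$ for each block $\{x,y\}$ of $\pi_2$, where $\tau$ sends $k\mapsto k''$ and fixes $[n]'$. Its components are paths between two vertices of $[n]\cup[n]'$ and cycles inside $[n]''$. Then $\xi\eta=(\pi;d_1+d_2+m)$, where the blocks of $\pi$ are the endpoint pairs of the paths and $m$ is the number of cycles. The identity is $(\{\{k,k'\}\};0)$. The reflection is $(\pi;d)^*=(\pi^*;d)$, obtained by swapping $k\leftrightarrow k'$ in every block; it is an involution. The hooks are $h_i=(\{\{i,i+1\},\{i',(i+1)'\}\}\cup\{\{j,j'\}\mid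 j\ne i,i+1\};0)$ and the circle is $c=(\{\{j,j'\}\mid j\in[n]\};1)$. The Kauffman monoid $\mathcal{K}_n$ is the submonoid of $\mathcal{W}_n$ generated by $c,h_1,\dots,h_{n-1}$. Equivalently, it is the monoid presented by $h_ih_j=h_jh_i$ for $|i-j|\ge2$, $h_ih_jh_i=h_i$ for $|i-j|=1$, and $h_i^2=ch_i=h_ic$. It is closed under ${}^*$, which fixes each generator. $\operatorname{var}\mathcal{S}$ denotes the variety of semigroups (resp. involution semigroups) generated by $\mathcal{S}$. A variety is nonfinitely based if it has no finite basis of identities. *)

theory Defs
  imports Main "HOL-Library.Disjoint_Sets"
begin

text \<open>Points of [n] union [n]': (k, False) stands for k, (k, True) stands for k'.\<close>
type_synonym point = "nat \<times> bool"
type_synonym wire = "point set set \<times> nat"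

definition pts :: "nat \<Rightarrow> point set" where
  "pts n = {1..n} \<times> UNIV"

definition wire_set :: "nat \<Rightarrow> wire set" where
  "wire_set n = {(p, d). partition_on (pts n) p \<and> (\<forall>B\<in>p. card B = 2)}"

text \<open>Vertices of the product graph: (k,0) = k, (k,1) = k'', (k,2) = k'.\<close>
definition sig :: "point \<Rightarrow> nat \<times> nat" where
  "sig x = (fst x, if snd x then 1 else 0)"

definition tau :: "point \<Rightarrow> nat \<times> nat" where
  "tau x = (fst x, if snd x then 2 else 1)"

definition outer :: "point \<Rightarrow> nat \<times> nat" where
  "outer x = (fst x, if snd x then 2 else 0)"

definition wgraph :: "point set set \<Rightarrow> point set set \<Rightarrow> ((nat \<times> nat) \<times> (nat \<times> nat)) set" where
  "wgraph p1 p2 = {(sig x, sig y) | x y. {x, y} \<in> p1} \<union> {(tau x, tau y) | x y. {x, y} \<in> p2}"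

text \<open>Connectivity (the edge relation is symmetric, so this is the component relation).\<close>
definition wconn :: "point set set \<Rightarrow> point set set \<Rightarrow> ((nat \<times> nat) \<times> (nat \<times> nat)) set" where
  "wconn p1 p2 = (wgraph p1 p2)\<^sup>*"

definition middle :: "nat \<Rightarrow> (nat \<times> nat) set" where
  "middle n = {1..n} \<times> {1}"

definition wmult :: "nat \<Rightarrow> wire \<Rightarrow> wire \<Rightarrow> wire" where
  "wmult n a b = (let C = wconn (fst a) (fst b) in
     ({{x, y} | x y. x \<in> pts n \<and> y \<in> pts n \<and> x \<noteq> y \<and> (outer x, outer y) \<in> C},
      snd a + snd b + card ((\<lambda>v. C `` {v}) ` {v \<in> middle n. C `` {v} \<subseteq> middle n})))"

definition wone :: "nat \<Rightarrow> wire" where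
  "wone n = ({{(k, False), (k, True)} | k. k \<in> {1..n}}, 0)"

definition wstar :: "wire \<Rightarrow> wire" where
  "wstar a = ((\<lambda>B. (\<lambda>(k, b). (k, \<not> b)) ` B) ` fst a, snd a)"

definition hook :: "nat \<Rightarrow> nat \<Rightarrow> wire" where
  "hook n i = ({{(i, False), (Suc i, False)}, {(i, True), (Suc i, True)}}
      \<union> {{(j, False), (j, True)} | j. j \<in> {1..n} \<and> j \<noteq> i \<and> j \<noteq> Suc i}, 0)"

definition circ :: "nat \<Rightarrow> wire" where
  "circ n = (fst (wone n), 1)"

inductive_set kauff :: "nat \<Rightarrow> wire set" for n where
  one: "wone n \<in> kauff n"
| circ: "circ n \<in> kauff n"
| hook: "1 \<le> i \<Longrightarrow> i < n \<Longrightarrow> hook n i \<in> kauff n"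
| mult: "a \<in> kauff n \<Longrightarrow> b \<in> kauff n \<Longrightarrow> wmult n a b \<in> kauff n"

text \<open>Semigroup words: nonempty lists of variables (nat).\<close>
fun sg_eval :: "('a \<Rightarrow> 'a \<Rightarrow> 'a) \<Rightarrow> (nat \<Rightarrow> 'a) \<Rightarrow> nat list \<Rightarrow> 'a" where
  "sg_eval m f [] = undefined"
| "sg_eval m f [x] = f x"
| "sg_eval m f (x # y # ys) = m (f x) (sg_eval m f (y # ys))"

definition sg_ids :: "(nat list \<times> nat list) set" where
  "sg_ids = {(u, v). u \<noteq> [] \<and> v \<noteq> []}"

definition sg_Id :: "'a set \<Rightarrow> ('a \<Rightarrow> 'a \<Rightarrow> 'a) \<Rightarrow> (nat list \<times> nat list) set" where
  "sg_Id S m = {(u, v) \<in> sg_ids. \<forall>f. (\<forall>x. f x \<in> S) \<longrightarrow> sg_eval m f u = sg_eval m f v}"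

definition sg_subst :: "(nat \<Rightarrow> nat list) \<Rightarrow> nat list \<Rightarrow> nat list" where
  "sg_subst th u = concat (map th u)"

inductive sg_deriv :: "(nat list \<times> nat list) set \<Rightarrow> nat list \<times> nat list \<Rightarrow> bool" for S where
  ax: "p \<in> S \<Longrightarrow> sg_deriv S p"
| refl: "u \<noteq> [] \<Longrightarrow> sg_deriv S (u, u)"
| sym: "sg_deriv S (u, v) \<Longrightarrow> sg_deriv S (v, u)"
| trans: "sg_deriv S (u, v) \<Longrightarrow> sg_deriv S (v, w) \<Longrightarrow> sg_deriv S (u, w)"
| subst: "sg_deriv S (u, v) \<Longrightarrow> (\<forall>x. th x \<noteq> []) \<Longrightarrow> sg_deriv S (sg_subst th u, sg_subst th v)"
| left: "sg_deriv S (u, v) \<Longrightarrow> w \<noteq> [] \<Longrightarrow> sg_deriv S (w @ u, w @ v)"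
| right: "sg_deriv S (u, v) \<Longrightarrow> w \<noteq> [] \<Longrightarrow> sg_deriv S (u @ w, v @ w)"

text \<open>A semigroup variety is represented by its equational theory.\<close>
definition sg_eq_theory :: "(nat list \<times> nat list) set \<Rightarrow> bool" where
  "sg_eq_theory T \<longleftrightarrow> T \<subseteq> sg_ids \<and> {p. sg_deriv T p} = T"

definition sg_finitely_based :: "(nat list \<times> nat list) set \<Rightarrow> bool" where
  "sg_finitely_based T \<longleftrightarrow> (\<exists>S. finite S \<and> S \<subseteq> sg_ids \<and> {p. sg_deriv S p} = T)"

text \<open>Involution words: nonempty lists of letters (x, b); b = True means x*.\<close>
type_synonym iword = "(nat \<times> bool) list"

definition iw_inv :: "iword \<Rightarrow> iword" where
  "iw_inv w = rev (map (\<lambda>(x, b). (x, \<not> b)) w)"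

definition letter_val :: "('a \<Rightarrow> 'a) \<Rightarrow> (nat \<Rightarrow> 'a) \<Rightarrow> nat \<times> bool \<Rightarrow> 'a" where
  "letter_val st f a = (if snd a then st (f (fst a)) else f (fst a))"

fun inv_eval :: "('a \<Rightarrow> 'a \<Rightarrow> 'a) \<Rightarrow> ('a \<Rightarrow> 'a) \<Rightarrow> (nat \<Rightarrow> 'a) \<Rightarrow> iword \<Rightarrow> 'a" where
  "inv_eval m st f [] = undefined"
| "inv_eval m st f [a] = letter_val st f a"
| "inv_eval m st f (a # b # ys) = m (letter_val st f a) (inv_eval m st f (b # ys))"

definition inv_ids :: "(iword \<times> iword) set" where
  "inv_ids = {(u, v). u \<noteq> [] \<and> v \<noteq> []}"

definition inv_Id :: "'a set \<Rightarrow> ('a \<Rightarrow> 'a \<Rightarrow> 'a) \<Rightarrow> ('a \<Rightarrow> 'a) \<Rightarrow> (iword \<times> iword) set" where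
  "inv_Id S m st = {(u, v) \<in> inv_ids. \<forall>f. (\<forall>x. f x \<in> S) \<longrightarrow> inv_eval m st f u = inv_eval m st f v}"

definition inv_subst :: "(nat \<Rightarrow> iword) \<Rightarrow> iword \<Rightarrow> iword" where
  "inv_subst th w = concat (map (\<lambda>(x, b). if b then iw_inv (th x) else th x) w)"

inductive inv_deriv :: "(iword \<times> iword) set \<Rightarrow> iword \<times> iword \<Rightarrow> bool" for S where
  ax: "p \<in> S \<Longrightarrow> inv_deriv S p"
| refl: "u \<noteq> [] \<Longrightarrow> inv_deriv S (u, u)"
| sym: "inv_deriv S (u, v) \<Longrightarrow> inv_deriv S (v, u)"
| trans: "inv_deriv S (u, v) \<Longrightarrow> inv_deriv S (v, w) \<Longrightarrow> inv_deriv S (u, w)"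
| subst: "inv_deriv S (u, v) \<Longrightarrow> (\<forall>x. th x \<noteq> []) \<Longrightarrow> inv_deriv S (inv_subst th u, inv_subst th v)"
| left: "inv_deriv S (u, v) \<Longrightarrow> w \<noteq> [] \<Longrightarrow> inv_deriv S (w @ u, w @ v)"
| right: "inv_deriv S (u, v) \<Longrightarrow> w \<noteq> [] \<Longrightarrow> inv_deriv S (u @ w, v @ w)"
| inv: "inv_deriv S (u, v) \<Longrightarrow> inv_deriv S (iw_inv u, iw_inv v)"

definition inv_eq_theory :: "(iword \<times> iword) set \<Rightarrow> bool" where
  "inv_eq_theory T \<longleftrightarrow> T \<subseteq> inv_ids \<and> {p. inv_deriv T p} = T"

definition inv_finitely_based :: "(iword \<times> iword) set \<Rightarrow> bool" where
  "inv_finitely_based T \<longleftrightarrow> (\<exists>S. finite S \<and> S \<subseteq> inv_ids \<and> {p. inv_deriv S p} = T)"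

end

theory Submission
  imports Defs "HOL-Library.Ramsey" "HOL-Library.FuncSet"
begin

text \<open>
  In \<open>K\<^sub>3\<close> a product of hook diagrams records, besides its first and last factor, the number of
  adjacent pairs \<open>xy\<close> through the number of loops. As \<open>K\<^sub>3\<close> has an identity element, an identity
  \<open>u = v\<close> of \<open>K\<^sub>3\<close> therefore forces \<open>u\<close> and \<open>v\<close> to have the same adjacent pairs after any, possibly
  erasing, substitution.

  Let \<open>Z\<^sub>m\<close> be the \<open>m\<close>-th iterate on the letter 0 of the substitution that sends the letter \<open>(i, j)\<close>
  of an \<open>r \<times> r\<close> alphabet to \<open>(i, 0)(j, 1)(i, 2)(j, 3)\<dots>\<close>, of length \<open>r\<close>. If \<open>u\<close> has fewer than
  \<open>r - 1\<close> letters and \<open>\<theta>u = Z\<^sub>m\<close>, some residue \<open>c > 0\<close> never starts an image of a letter, so every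
  adjacent pair of residues \<open>c - 1, c\<close> lies inside one image and determines its block. Decoding these
  pairs reduces \<open>m\<close> by one, and comparing adjacent pairs after deleting all residues but \<open>c\<close> and \<open>t\<close>
  recovers the remaining letters: \<open>\<theta>v = Z\<^sub>m\<close>. Hence identities of \<open>K\<^sub>3\<close> in few variables cannot change
  \<open>Z\<^sub>m\<close>.

  On the other hand, by Ramsey's theorem a long \<open>Z\<^sub>m\<close> factors as \<open>s a b c t\<close> where \<open>a\<close>, \<open>b\<close>, \<open>c\<close> induce, under
  every assignment, the same idempotent map on the partitions of \<open>W\<^sub>n\<close>; then \<open>W\<^sub>n\<close> satisfies
  \<open>s a b c t = s b a c t\<close>, which is not trivial because \<open>Z\<^sub>m\<close> is square-free. In the involution case,
  letters carry a polarity, and every identity applicable to a positive word uses each variable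
  with one polarity only.
\<close>

section \<open>A model of the identities of the Kauffman monoid\<close>

text \<open>\<open>(Some (i, j), d)\<close> is the diagram with \<open>d\<close> loops, upper arc \<open>i\<close> and lower arc \<open>j\<close>, where \<open>True\<close>
  is the arc of \<open>h\<^sub>1\<close> and \<open>False\<close> that of \<open>h\<^sub>2\<close>; \<open>(None, d)\<close> is \<open>c\<^sup>d\<close>.\<close>

type_synonym kmodel = "(bool \<times> bool) option \<times> nat"

fun kmul :: "kmodel \<Rightarrow> kmodel \<Rightarrow> kmodel" where
  "kmul (None, d) (b, e) = (b, d + e)"
| "kmul (Some a, d) (None, e) = (Some a, d + e)"
| "kmul (Some (i, j), d) (Some (k, l), e) = (Some (i, l), d + e + (if j = k then 1 else 0))"

lemma kmul_assoc: "kmul (kmul a b) c = kmul a (kmul b c)"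
  by (cases "(a, b)" rule: kmul.cases; cases b; cases "fst b"; cases c; cases "fst c") auto

lemma kmul_one [simp]: "kmul (None, 0) a = a" "kmul a (None, 0) = a"
  by (cases a; simp) (cases "(a, (None, 0) :: kmodel)" rule: kmul.cases; simp)

definition keval :: "('a \<Rightarrow> kmodel) \<Rightarrow> 'a list \<Rightarrow> kmodel" where
  "keval g u = foldr (\<lambda>x. kmul (g x)) u (None, 0)"

lemma keval_simps [simp]:
  "keval g [] = (None, 0)" "keval g (x # u) = kmul (g x) (keval g u)"
  by (simp_all add: keval_def)

lemma keval_append [simp]: "keval g (u @ v) = kmul (keval g u) (keval g v)"
  by (induction u) (simp_all add: kmul_assoc)

lemma keval_concat_map: "keval g (concat (map \<phi> u)) = keval (\<lambda>x. keval g (\<phi> x)) u"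
  by (induction u) simp_all

lemma keval_cong: "(\<And>x. x \<in> set u \<Longrightarrow> g x = h x) \<Longrightarrow> keval g u = keval h u"
  by (induction u) simp_all

section \<open>Identities of the model and what they preserve\<close>

definition kid :: "'a list \<Rightarrow> 'a list \<Rightarrow> bool" where
  "kid u v \<longleftrightarrow> (\<forall>g. keval g u = keval g v)"

lemma kid_sym: "kid u v \<Longrightarrow> kid v u"
  by (simp add: kid_def)

text \<open>The empty word evaluates to the identity of the model, so \<open>\<phi>\<close> may
  erase letters; deleting letters is the main use.\<close>

lemma kid_morphism: "kid u v \<Longrightarrow> kid (concat (map \<phi> u)) (concat (map \<phi> v))"
  by (simp add: kid_def keval_concat_map)

lemma filter_conv_concat: "filter P u = concat (map (\<lambda>x. if P x then [x] else []) u)"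
  by (induction u) simp_all

lemma kid_filter: "kid u v \<Longrightarrow> kid (filter P u) (filter P v)"
  unfolding filter_conv_concat by (rule kid_morphism)

lemma map_conv_concat: "map f u = concat (map (\<lambda>x. [f x]) u)"
  by (induction u) simp_all

lemma kid_map: "kid u v \<Longrightarrow> kid (map f u) (map f v)"
  by (subst (1 2) map_conv_concat) (rule kid_morphism)

lemma kid_context: "kid u v \<Longrightarrow> kid (s @ u @ t) (s @ v @ t)"
  by (simp add: kid_def)

text \<open>Upper and lower arcs are chosen independently, so \<open>xy\<close> closes a loop
  exactly when \<open>\<alpha> x = \<beta> y\<close>.\<close>

definition hooks :: "('a \<Rightarrow> bool) \<Rightarrow> ('a \<Rightarrow> bool) \<Rightarrow> 'a \<Rightarrow> kmodel" where
  "hooks \<alpha> \<beta> x = (Some (\<beta> x, \<alpha> x), 0)"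

lemma fst_keval_hooks:
  "u \<noteq> [] \<Longrightarrow> fst (keval (hooks \<alpha> \<beta>) u) = Some (\<beta> (hd u), \<alpha> (last u))"
proof (induction u rule: induct_list012)
  case (3 x y u)
  then obtain d where "keval (hooks \<alpha> \<beta>) (y # u) = (Some (\<beta> y, \<alpha> (last (y # u))), d)"
    by (metis list.sel(1) list.distinct(1) prod.collapse)
  then have "keval (hooks \<alpha> \<beta>) (x # y # u) = kmul (hooks \<alpha> \<beta> x) (Some (\<beta> y, \<alpha> (last (y # u))), d)"
    by simp
  also have "fst \<dots> = Some (\<beta> x, \<alpha> (last (y # u)))"
    by (simp add: hooks_def)
  finally show ?case by simp
qed (simp_all add: hooks_def)

definition loops :: "('a \<Rightarrow> bool) \<Rightarrow> ('a \<Rightarrow> bool) \<Rightarrow> 'a list \<Rightarrow> nat" where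
  "loops \<alpha> \<beta> u = length (filter (\<lambda>(x, y). \<alpha> x = \<beta> y) (zip u (tl u)))"

lemma snd_keval_hooks: "snd (keval (hooks \<alpha> \<beta>) u) = loops \<alpha> \<beta> u"
proof (induction u rule: induct_list012)
  case (3 x y u)
  obtain d where d: "keval (hooks \<alpha> \<beta>) (y # u) = (Some (\<beta> y, \<alpha> (last (y # u))), d)"
    by (metis fst_keval_hooks list.sel(1) list.distinct(1) prod.collapse)
  then have "keval (hooks \<alpha> \<beta>) (x # y # u) = kmul (hooks \<alpha> \<beta> x) (Some (\<beta> y, \<alpha> (last (y # u))), d)"
    by simp
  also have "snd \<dots> = d + (if \<alpha> x = \<beta> y then 1 else 0)"
    by (simp add: hooks_def)
  also have "d = loops \<alpha> \<beta> (y # u)"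
    using 3(2) d by simp
  finally show ?case by (simp add: loops_def)
qed (simp_all add: hooks_def loops_def)

text \<open>With truth values read as 0 and 1, \<open>[\<alpha> = \<beta>] = 1 - \<alpha> - \<beta> + 2\<alpha>\<beta>\<close>.\<close>

lemma loops_polarization:
  "loops \<alpha> \<beta> u + loops (\<lambda>_. False) (\<lambda>_. False) u =
   loops \<alpha> (\<lambda>_. False) u + loops (\<lambda>_. False) \<beta> u
     + 2 * length (filter (\<lambda>(x, y). \<alpha> x \<and> \<beta> y) (zip u (tl u)))"
  by (induction u rule: induct_list012) (auto simp: loops_def)

lemma kid_loops: "kid u v \<Longrightarrow> loops \<alpha> \<beta> u = loops \<alpha> \<beta> v"
  by (metis kid_def snd_keval_hooks)

text \<open>Taking indicators of \<open>a\<close> and \<open>b\<close> for \<open>\<alpha>\<close>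
  and \<open>\<beta>\<close>, the polarization expresses the number of occurrences of
  \<open>ab\<close> through loop counts, which the identity preserves.\<close>

lemma kid_adjacent:
  assumes "kid u v"
  shows "set (zip u (tl u)) = set (zip v (tl v))"
proof -
  have "length (filter (\<lambda>(x, y). x = a \<and> y = b) (zip u (tl u)))
      = length (filter (\<lambda>(x, y). x = a \<and> y = b) (zip v (tl v)))" for a b
    using loops_polarization[of "\<lambda>x. x = a" "\<lambda>x. x = b" u] loops_polarization[of "\<lambda>x. x = a" "\<lambda>x. x = b" v]
    by (simp add: kid_loops[OF assms])
  moreover have "(a, b) \<in> set w \<longleftrightarrow> length (filter (\<lambda>(x, y). x = a \<and> y = b) w) \<noteq> 0" for a b and w :: "('a \<times> 'a) list"
    by (auto simp: filter_empty_conv)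
  ultimately have "(a, b) \<in> set (zip u (tl u)) \<longleftrightarrow> (a, b) \<in> set (zip v (tl v))" for a b
    by metis
  then show ?thesis by auto
qed

text \<open>When all letters are hook diagrams, only the empty word yields a power of the
  circle.\<close>

lemma kid_Nil_iff:
  assumes "kid u v"
  shows "u = [] \<longleftrightarrow> v = []"
proof -
  have "w = [] \<longleftrightarrow> fst (keval (hooks (\<lambda>_. True) (\<lambda>_. True)) w) = None" for w :: "'a list"
    using fst_keval_hooks[of w "\<lambda>_. True" "\<lambda>_. True"] by fastforce
  then show ?thesis using assms by (simp add: kid_def)
qed

lemma kid_set:
  assumes "kid u v"
  shows "set u = set v"
proof -
  have "x \<in> set u \<longleftrightarrow> x \<in> set v" for x
    using kid_Nil_iff[OF kid_filter[OF assms, of "\<lambda>y. y = x"]] by (auto simp: filter_empty_conv)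
  then show ?thesis by blast
qed

lemma kid_hd_last:
  assumes "kid u v" "u \<noteq> []"
  shows "hd u = hd v" "last u = last v"
proof -
  have "fst (keval (hooks \<alpha> \<beta>) u) = fst (keval (hooks \<alpha> \<beta>) v)" for \<alpha> \<beta>
    using assms by (simp add: kid_def)
  then have *: "\<beta> (hd u) = \<beta> (hd v) \<and> \<alpha> (last u) = \<alpha> (last v)" for \<alpha> \<beta> :: "'a \<Rightarrow> bool"
    using fst_keval_hooks[of u \<alpha> \<beta>] fst_keval_hooks[of v \<alpha> \<beta>] assms kid_Nil_iff[OF assms(1)]
    by simp
  show "hd u = hd v" "last u = last v"
    using *[of "\<lambda>x. x = hd u" "\<lambda>x. x = last u"] by auto
qed

lemma kid_singleton:
  assumes "kid [a] v"
  shows "v = [a]"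
proof -
  have "v \<noteq> []" "hd v = a" "zip v (tl v) = []"
    using kid_Nil_iff[OF assms] kid_hd_last[OF assms] kid_adjacent[OF assms] by auto
  then show ?thesis by (cases v; cases "tl v") auto
qed


section \<open>Words cut into blocks of fixed length\<close>

lemma adjacent_nth:
  "Suc i < length u \<Longrightarrow> (u ! i, u ! Suc i) \<in> set (zip u (tl u))"
  by (force simp: set_zip nth_tl)

lemma concat_map_upt:
  "concat (map (\<lambda>q. map (\<lambda>t. h (q * r + t)) [0..<r]) [0..<n]) = map h [0..<n * r]"
proof (induction n)
  case (Suc n)
  have "[0..<Suc n * r] = [0..<n * r] @ map (\<lambda>t. n * r + t) [0..<r]"
    using upt_add_eq_append[of 0 "n * r" r] by (simp add: add.commute map_add_upt)
  then show ?case using Suc by (simp add: comp_def)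
qed simp

text \<open>An adjacent pair is either a block or a seam between two blocks, and a seam starts with
  a value of \<open>g\<close>.\<close>

lemma zip_tl_concat_pairs:
  "set (zip (concat (map (\<lambda>b. [f b, g b]) bs)) (tl (concat (map (\<lambda>b. [f b, g b]) bs))))
    \<subseteq> {(f b, g b) | b. b \<in> set bs} \<union> range g \<times> UNIV"
proof (induction bs)
  case (Cons b bs)
  show ?case
  proof (cases bs)
    case Nil
    then show ?thesis by auto
  next
    case (Cons b' bs')
    then show ?thesis using Cons.IH by auto
  qed
qed simp

lemma adjacent_concat_pairs:
  "b \<in> set bs \<Longrightarrow> (f b, g b) \<in> set (zip (concat (map (\<lambda>b. [f b, g b]) bs)) (tl (concat (map (\<lambda>b. [f b, g b]) bs))))"
proof (induction bs)
  case (Cons b bs)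
  then show ?case by (cases bs) auto
qed simp

lemma filter_upt_two:
  assumes "(s::nat) < t" "t < r"
  shows "filter (\<lambda>i. i = s \<or> i = t) [0..<r] = [s, t]"
  using assms by (intro sorted_distinct_set_unique) (auto simp: sorted_wrt_filter)

lemma filter_upt_one:
  assumes "(s::nat) < r"
  shows "filter (\<lambda>i. i = s) [0..<r] = [s]"
  using assms by (intro sorted_distinct_set_unique) (auto simp: sorted_wrt_filter)

lemma filter_blocks:
  assumes "\<And>b t. b \<in> set bs \<Longrightarrow> t < r \<Longrightarrow> \<rho> (b t) = t"
  shows "filter (\<lambda>x. P (\<rho> x)) (concat (map (\<lambda>b. map b [0..<r]) bs))
    = concat (map (\<lambda>b. map b (filter P [0..<r])) bs)"
proof -
  have "filter (\<lambda>x. P (\<rho> x)) (map b [0..<r]) = map b (filter P [0..<r])" if "b \<in> set bs" for b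
    using assms[OF that] by (auto simp: filter_map comp_def intro!: arg_cong[where f = "map b"] filter_cong)
  then show ?thesis by (simp add: filter_concat comp_def cong: map_cong)
qed

text \<open>The conditions force residue \<open>i mod r\<close> at position \<open>i\<close> and
  make \<open>r\<close> divide the length. A block is represented as a function from positions to
  letters.\<close>

lemma blocks_of_residues:
  assumes r: "0 < r"
    and hd: "V \<noteq> [] \<Longrightarrow> \<rho> (hd V) = 0" and last: "V \<noteq> [] \<Longrightarrow> Suc (\<rho> (last V)) = r"
    and adj: "\<And>x y. (x, y) \<in> set (zip V (tl V)) \<Longrightarrow> \<rho> y = (Suc (\<rho> x)) mod r"
  obtains bs where "V = concat (map (\<lambda>b. map b [0..<r]) bs)"
    "\<And>b t. b \<in> set bs \<Longrightarrow> t < r \<Longrightarrow> \<rho> (b t) = t"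
proof -
  have nth: "\<rho> (V ! i) = i mod r" if "i < length V" for i
    using that
  proof (induction i)
    case 0
    then show ?case using hd by (simp add: hd_conv_nth)
  next
    case (Suc i)
    then show ?case using adj[OF adjacent_nth[of i V]] by (simp add: mod_Suc_eq)
  qed
  have "r dvd length V"
  proof (cases "V = []")
    case False
    then have "Suc ((length V - 1) mod r) = r"
      using last nth[of "length V - 1"] by (simp add: last_conv_nth)
    then have "Suc (length V - 1) mod r = 0"
      by (simp add: mod_Suc)
    then show ?thesis using False by (simp add: dvd_eq_mod_eq_0)
  qed simp
  then obtain n where n: "length V = n * r" by (metis dvd_def mult.commute)
  have "V = concat (map (\<lambda>b. map b [0..<r]) (map (\<lambda>q t. V ! (q * r + t)) [0..<n]))"
    using concat_map_upt[of "(!) V" r n] by (simp add: comp_def map_nth flip: n)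
  moreover have "\<rho> (V ! (q * r + t)) = t" if "q < n" "t < r" for q t
  proof -
    have "q * r + t < Suc q * r" using that by simp
    also have "\<dots> \<le> n * r" using that by (intro mult_le_mono1) simp
    finally show ?thesis using nth n that by simp
  qed
  ultimately show ?thesis
    by (intro that[of "map (\<lambda>q t. V ! (q * r + t)) [0..<n]"]) auto
qed

lemma adjacent_blocks:
  assumes "\<And>b t. b \<in> set bs \<Longrightarrow> t < r \<Longrightarrow> \<rho> (b t) = t" and "0 < r"
    and "U = concat (map (\<lambda>b. map b [0..<r]) bs)"
  shows "U \<noteq> [] \<Longrightarrow> \<rho> (hd U) = 0" "U \<noteq> [] \<Longrightarrow> Suc (\<rho> (last U)) = r"
    "(x, y) \<in> set (zip U (tl U)) \<Longrightarrow> \<rho> y = (Suc (\<rho> x)) mod r"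
proof -
  obtain n where n: "n = length bs" by simp
  have U: "U = map (\<lambda>i. (bs ! (i div r)) (i mod r)) [0..<n * r]"
  proof -
    have "U = concat (map (\<lambda>q. map (\<lambda>t. (bs ! q) t) [0..<r]) [0..<n])"
      unfolding assms(3) n by (subst map_nth[of bs, symmetric]) (simp only: map_map comp_def)
    also have "\<dots> = concat (map (\<lambda>q. map (\<lambda>t. (bs ! ((q * r + t) div r)) ((q * r + t) mod r)) [0..<r]) [0..<n])"
      by (intro arg_cong[where f = concat] map_cong) auto
    finally show ?thesis
      by (simp only: concat_map_upt[of "\<lambda>i. (bs ! (i div r)) (i mod r)"])
  qed
  have rho: "\<rho> (U ! i) = i mod r" if "i < length U" for i
    using that assms(1)[of "bs ! (i div r)" "i mod r"] assms(2) n
    by (simp add: U less_mult_imp_div_less)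
  show "\<rho> (hd U) = 0" if "U \<noteq> []" using rho[of 0] that by (simp add: hd_conv_nth)
  show "Suc (\<rho> (last U)) = r" if "U \<noteq> []"
  proof -
    have *: "length U = n * r" by (simp add: U)
    moreover have "n \<noteq> 0" using * that by (metis length_0_conv mult_zero_left)
    ultimately obtain k where "n = Suc k" by (cases n) auto
    then have "length U - 1 = k * r + (r - 1)" using * assms(2) by simp
    then have "(length U - 1) mod r = (r - 1) mod r" by (simp only: mod_mult_self3)
    then have "(length U - 1) mod r = r - 1" using assms(2) by simp
    then show ?thesis using rho[of "length U - 1"] that assms(2) by (simp add: last_conv_nth)
  qed
  show "\<rho> y = (Suc (\<rho> x)) mod r" if "(x, y) \<in> set (zip U (tl U))"
    using that rho by (auto simp: set_zip nth_tl mod_Suc_eq)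
qed

text \<open>Adjacent pairs carry the residue pattern of \<open>U\<close> over to \<open>V\<close>,
  so \<open>V\<close> splits into blocks too. Each of them is some \<open>B a\<close>, with
  \<open>a\<close> read off at position \<open>c\<close>, and \<open>w\<close> fixes the order of
  these \<open>a\<close>.\<close>

lemma kid_blocks_rigid:
  assumes c: "c < r"
    and \<rho>: "\<And>a t. t < r \<Longrightarrow> \<rho> (B a t) = t"
    and dec: "\<And>a. dec (B a c) = a"
    and U: "U = concat (map (\<lambda>a. map (B a) [0..<r]) w)"
    and kid: "kid U V"
    and w: "map dec (filter (\<lambda>x. \<rho> x = c) V) = w"
  shows "V = U"
proof -
  have U': "U = concat (map (\<lambda>b. map b [0..<r]) (map B w))"
    by (simp add: U comp_def)
  have \<rho>': "\<rho> (b t) = t" if "b \<in> set (map B w)" "t < r" for b t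
    using that \<rho> by auto
  have adjU: "U \<noteq> [] \<Longrightarrow> \<rho> (hd U) = 0" "U \<noteq> [] \<Longrightarrow> Suc (\<rho> (last U)) = r"
    "(x, y) \<in> set (zip U (tl U)) \<Longrightarrow> \<rho> y = (Suc (\<rho> x)) mod r" for x y
    using adjacent_blocks[where \<rho> = \<rho> and bs = "map B w" and r = r and U = U] \<rho>' U' c by blast+
  obtain bs where V: "V = concat (map (\<lambda>b. map b [0..<r]) bs)"
    and bs: "\<And>b t. b \<in> set bs \<Longrightarrow> t < r \<Longrightarrow> \<rho> (b t) = t"
  proof (rule blocks_of_residues[of r V \<rho>])
    show "\<rho> (hd V) = 0" "Suc (\<rho> (last V)) = r" if "V \<noteq> []"
      using that adjU kid_Nil_iff[OF kid] kid_hd_last[OF kid] by auto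
    show "\<rho> y = (Suc (\<rho> x)) mod r" if "(x, y) \<in> set (zip V (tl V))" for x y
      using that adjU(3) kid_adjacent[OF kid] by auto
  qed (use c in auto)
  \<comment> \<open>Deleting all residues except \<open>s\<close> and \<open>t\<close> makes these
    two letters of a block adjacent; a seam of the filtered \<open>U\<close> starts with residue
    \<open>t\<close>, hence cannot be this pair.\<close>
  have pair: "\<exists>a. b s = B a s \<and> b t = B a t" if b: "b \<in> set bs" and st: "s < t" "t < r" for b s t
  proof -
    let ?P = "\<lambda>i. i = s \<or> i = t"
    have fU: "filter (\<lambda>x. ?P (\<rho> x)) U = concat (map (\<lambda>a. [B a s, B a t]) w)"
      unfolding U' using \<rho> by (subst filter_blocks) (auto simp: filter_upt_two[OF st] comp_def)
    have fV: "filter (\<lambda>x. ?P (\<rho> x)) V = concat (map (\<lambda>b. [b s, b t]) bs)"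
      unfolding V using bs by (subst filter_blocks) (auto simp: filter_upt_two[OF st] comp_def)
    have "(b s, b t) \<in> set (zip (filter (\<lambda>x. ?P (\<rho> x)) U) (tl (filter (\<lambda>x. ?P (\<rho> x)) U)))"
      using adjacent_concat_pairs[OF b, of "\<lambda>b. b s" "\<lambda>b. b t"] kid_adjacent[OF kid_filter[OF kid, of "\<lambda>x. ?P (\<rho> x)"]]
      by (simp add: fV)
    then have "(b s, b t) \<in> {(B a s, B a t) | a. a \<in> set w} \<union> range (\<lambda>a. B a t) \<times> UNIV"
      using zip_tl_concat_pairs[of "\<lambda>a. B a s" "\<lambda>a. B a t" w] unfolding fU by blast
    moreover have "b s \<notin> range (\<lambda>a. B a t)"
    proof
      assume "b s \<in> range (\<lambda>a. B a t)"
      then obtain a where "b s = B a t" by auto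
      then have "s = t" using bs[OF b, of s] \<rho>[of t a] st by simp
      then show False using st by simp
    qed
    ultimately show ?thesis by auto
  qed
  have b: "b t = B (dec (b c)) t" if "b \<in> set bs" "t < r" for b t
  proof (cases t c rule: linorder_cases)
    case less
    then show ?thesis using pair[of b t c] that c dec by metis
  next
    case greater
    then show ?thesis using pair[of b c t] that c dec by metis
  next
    case equal
    \<comment> \<open>No second position is available here, so the letter itself is located in
      \<open>U\<close>; its residue shows that it stands at position \<open>c\<close> there.\<close>
    have "b c \<in> set U" unfolding kid_set[OF kid] V using that c by fastforce
    then obtain a t' where a: "b c = B a t'" "t' < r" by (auto simp: U)
    then have "t' = c" using bs[OF that(1) c] \<rho>[of t' a] by simp
    then show ?thesis using a dec equal by simp
  qed
  have "w = map (\<lambda>b. dec (b c)) bs"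
    unfolding w[symmetric] V using bs
    by (subst filter_blocks[where P = "\<lambda>i. i = c"]) (auto simp: filter_upt_one[OF c])
  then have "U = concat (map (\<lambda>b. map (B (dec (b c))) [0..<r]) bs)"
    by (simp add: U comp_def)
  also have "\<dots> = V"
    unfolding V using b by (intro arg_cong[where f = concat] map_cong) auto
  finally show ?thesis by simp
qed


section \<open>A square-free word that identities in few variables preserve\<close>

text \<open>The letter \<open>(i, j)\<close> of the \<open>r \<times> r\<close> alphabet is coded as \<open>i * r + j\<close>.\<close>

definition blk :: "nat \<Rightarrow> nat \<Rightarrow> nat \<Rightarrow> nat" where
  "blk r a t = (if even t then a div r else a mod r) * r + t"

lemma blk_mod: "t < r \<Longrightarrow> blk r a t mod r = t"
  by (simp add: blk_def)

lemma blk_div: "t < r \<Longrightarrow> blk r a t div r = (if even t then a div r else a mod r)"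
  by (simp add: blk_def)

lemma blk_less: "a < r * r \<Longrightarrow> t < r \<Longrightarrow> blk r a t < r * r"
proof -
  assume *: "a < r * r" "t < r"
  let ?q = "if even t then a div r else a mod r"
  have "?q < r" using * by (simp add: less_mult_imp_div_less)
  then have "Suc ?q * r \<le> r * r" by (intro mult_le_mono1) simp
  then show ?thesis using * unfolding blk_def by (simp add: add.commute)
qed

text \<open>Two neighbouring positions \<open>t\<close> and \<open>t + 1\<close> of a block carry
  both coordinates of the coded letter; the parity of \<open>t\<close> tells which is which.\<close>

definition unblk :: "nat \<Rightarrow> nat \<Rightarrow> nat \<Rightarrow> nat \<Rightarrow> nat" where
  "unblk r t p q = (if even t then p div r * r + q div r else q div r * r + p div r)"

lemma unblk_blk: "Suc t < r \<Longrightarrow> unblk r t (blk r a t) (blk r a (Suc t)) = a"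
  by (simp add: unblk_def blk_div)

section \<open>An infinite square-free word\<close>

function xw :: "nat \<Rightarrow> nat \<Rightarrow> nat" where
  "xw r i = (if i = 0 \<or> r < 2 then 0 else blk r (xw r (i div r)) (i mod r))"
  by auto
termination by (relation "measure snd") auto

declare xw.simps [simp del]

text \<open>The recursion extends to position 0, where the definition stops, because the block of
  the letter 0 starts with 0.\<close>

lemma xw_rec: "2 \<le> r \<Longrightarrow> xw r i = blk r (xw r (i div r)) (i mod r)"
  by (subst xw.simps) (auto simp: xw.simps[of r 0] blk_def)

lemma xw_mod: "2 \<le> r \<Longrightarrow> xw r i mod r = i mod r"
  by (subst xw_rec) (auto simp: blk_mod)

lemma xw_less: "2 \<le> r \<Longrightarrow> xw r i < r * r"
proof (induction i rule: less_induct)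
  case (less i)
  show ?case
  proof (cases "i = 0")
    case False
    then have "xw r (i div r) < r * r" using less by auto
    then show ?thesis using less.prems by (subst xw_rec) (auto intro!: blk_less)
  qed (use less.prems in \<open>auto simp: xw.simps\<close>)
qed

text \<open>Infinite descent: residues make the period \<open>k\<close> a multiple of
  \<open>r\<close>, and decoding one pair of neighbours per block gives a square of period
  \<open>k div r\<close>.\<close>

lemma xw_squarefree:
  assumes "3 \<le> r" "0 < k"
  shows "\<not> (\<forall>j<k. xw r (i + j) = xw r (i + k + j))"
  using assms(2)
proof (induction k arbitrary: i rule: less_induct)
  case (less k)
  show ?case
  proof
    assume sq: "\<forall>j<k. xw r (i + j) = xw r (i + k + j)"
    have "i mod r = (i + k) mod r"
      using sq[rule_format, of 0] less.prems assms(1) xw_mod[of r i] xw_mod[of r "i + k"] by simp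
    then have "r dvd k" using mod_eq_dvd_iff_nat[of i "i + k" r] by simp
    then obtain k' where k: "k = k' * r" by (metis dvd_def mult.commute)
    then have k': "0 < k'" "k' < k" using less.prems assms(1) by auto
    define q e where "q = i div r" and "e = i mod r"
    have i: "i = q * r + e" and e: "e < r" using assms(1) by (auto simp: q_def e_def)
    have xw: "xw r (x * r + t) = blk r (xw r x) t" if "t < r" for x t
      using that assms(1) by (subst xw_rec) auto
    \<comment> \<open>Two neighbours inside block \<open>p\<close>, both in the first half of the
      square, agree with those in block \<open>p + k'\<close>, and such a pair determines the
      block.\<close>
    have eq: "xw r p = xw r (p + k')" if "Suc t < r" "i \<le> p * r + t" "p * r + Suc t < i + k" for p t
    proof -
      have "blk r (xw r p) s = blk r (xw r (p + k')) s" if "s = t \<or> s = Suc t" for s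
      proof -
        have "s < r" using that \<open>Suc t < r\<close> by auto
        moreover have "xw r (p * r + s) = xw r ((p + k') * r + s)"
          using sq[rule_format, of "p * r + s - i"] that \<open>i \<le> p * r + t\<close> \<open>p * r + Suc t < i + k\<close>
          by (auto simp: k algebra_simps)
        ultimately show ?thesis by (simp add: xw)
      qed
      then show ?thesis
        using unblk_blk[OF \<open>Suc t < r\<close>, of "xw r p"] unblk_blk[OF \<open>Suc t < r\<close>, of "xw r (p + k')"]
        by (metis)
    qed
    show False
    proof (cases "Suc e < r")
      case True
      have "xw r (q + j) = xw r (q + k' + j)" if "j < k'" for j
      proof -
        have "Suc j * r \<le> k" unfolding k using that by (intro mult_le_mono1) simp
        then have "xw r (q + j) = xw r (q + j + k')"
          using True by (intro eq[of e]) (auto simp: i algebra_simps)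
        then show ?thesis by (simp add: add_ac)
      qed
      then show False using less.IH[OF k'(2,1)] by blast
    next
      case False
      \<comment> \<open>The square starts at the last letter of a block, so the first two letters of
        the following blocks are used; \<open>3 \<le> r\<close> keeps the last such pair in the
        first half.\<close>
      have "xw r (Suc q + j) = xw r (Suc q + k' + j)" if "j < k'" for j
      proof -
        have "Suc j * r \<le> k" unfolding k using that by (intro mult_le_mono1) simp
        then have "xw r (Suc q + j) = xw r (Suc q + j + k')"
          using False e assms(1) by (intro eq[of 0]) (auto simp: i algebra_simps)
        then show ?thesis by (simp add: add_ac)
      qed
      then show False using less.IH[OF k'(2,1)] by blast
    qed
  qed
qed

text \<open>\<open>xw r\<close> is the infinite fixed point of the block substitution.\<close>

definition zw :: "nat \<Rightarrow> nat \<Rightarrow> nat list" where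
  "zw r m = map (xw r) [0..<r ^ m]"

lemma zw_0: "zw r 0 = [0]"
  by (simp add: zw_def xw.simps)

lemma zw_Suc:
  assumes "2 \<le> r"
  shows "zw r (Suc m) = concat (map (\<lambda>a. map (blk r a) [0..<r]) (zw r m))"
proof -
  have "concat (map (\<lambda>a. map (blk r a) [0..<r]) (zw r m))
      = concat (map (\<lambda>q. map (\<lambda>t. xw r (q * r + t)) [0..<r]) [0..<r ^ m])"
    unfolding zw_def map_map comp_def
  proof (intro arg_cong[where f = concat] map_cong refl)
    show "blk r (xw r q) t = xw r (q * r + t)" if "t \<in> set [0..<r]" for q t
      using that assms xw_rec[of r "q * r + t"] by simp
  qed simp_all
  then show ?thesis by (simp add: concat_map_upt zw_def mult.commute)
qed

text \<open>Within a block, a letter together with its predecessor determines the block.\<close>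

fun annot :: "nat \<Rightarrow> nat \<Rightarrow> nat \<Rightarrow> nat list \<Rightarrow> (nat \<times> nat) list" where
  "annot r c p [] = []"
| "annot r c p (q # g) = (q, if q mod r = c then p else 0) # annot r c q g"

lemma map_fst_annot: "map fst (annot r c p g) = g"
  by (induction g arbitrary: p) auto

lemma annot_append: "annot r c p (g @ h) = annot r c p g @ annot r c (last (p # g)) h"
  by (induction g arbitrary: p) auto

lemma annot_start: "g = [] \<or> hd g mod r \<noteq> c \<Longrightarrow> annot r c p g = annot r c p' g"
  by (cases g) auto

text \<open>If no image starts with residue \<open>c\<close>, no annotation looks across a boundary
  between images, so annotating is again a substitution.\<close>

lemma annot_concat:
  assumes "\<And>x. x \<in> set u \<Longrightarrow> \<theta> x = [] \<or> hd (\<theta> x) mod r \<noteq> c"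
  shows "annot r c p (concat (map \<theta> u)) = concat (map (\<lambda>x. annot r c 0 (\<theta> x)) u)"
  using assms
proof (induction u arbitrary: p)
  case (Cons x u)
  then show ?case
    using annot_start[of "\<theta> x" r c p 0] by (simp add: annot_append)
qed simp

lemma annot_map_upt:
  assumes "\<And>t. t < N \<Longrightarrow> h t mod r = t"
  shows "annot r c p (map h [0..<N]) = map (\<lambda>t. (h t, if t = c then (if t = 0 then p else h (t - 1)) else 0)) [0..<N]"
  using assms
proof (induction N)
  case (Suc N)
  have "last (p # map h [0..<N]) = (if N = 0 then p else h (N - 1))"
    by (simp add: last_map)
  then show ?case using Suc by (simp add: annot_append)
qed simp

text \<open>Induction on \<open>m\<close> for all \<open>\<theta>\<close> at once: annotating the
  images and decoding residue \<open>c\<close> gives a substitution that sends \<open>u\<close> to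
  the previous iterate. Rigidity of blocks then lifts the equality back.\<close>

theorem zw_isolated:
  fixes u v :: "'a list"
  assumes "kid u v" "card (set u) + 2 \<le> r" "concat (map \<theta> u) = zw r m"
  shows "concat (map \<theta> v) = zw r m"
  using assms(3)
proof (induction m arbitrary: \<theta>)
  case 0
  then show ?case using kid_morphism[OF assms(1), of \<theta>] kid_singleton by (metis zw_0)
next
  case (Suc m)
  have r: "2 \<le> r" using assms(2) by simp
  \<comment> \<open>Pigeonhole: at most \<open>r - 2\<close> initial residues against
    \<open>r - 1\<close> nonzero ones. A nonzero \<open>c\<close> has its predecessor in the same
    block.\<close>
  have "card ((\<lambda>x. hd (\<theta> x) mod r) ` set u) < card {1..<r}"
    using card_image_le[of "set u" "\<lambda>x. hd (\<theta> x) mod r"] assms(2) by simp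
  then have "\<not> {1..<r} \<subseteq> (\<lambda>x. hd (\<theta> x) mod r) ` set u"
    by (meson card_mono finite_imageI finite_set leD)
  then obtain c where c: "1 \<le> c" "c < r" "\<And>x. x \<in> set u \<Longrightarrow> hd (\<theta> x) mod r \<noteq> c"
    by fastforce
  define \<Phi> where "\<Phi> x = annot r c 0 (\<theta> x)" for x
  define B where "B a t = (blk r a t, if t = c then blk r a (c - 1) else 0)" for a t
  define dec where "dec z = unblk r (c - 1) (snd z) (fst z)" for z
  define \<rho> where "\<rho> z = fst z mod r" for z :: "nat \<times> nat"
  define \<Psi> where "\<Psi> U = map dec (filter (\<lambda>z. \<rho> z = c) U)" for U
  have annot: "annot r c 0 (concat (map \<theta> w)) = concat (map \<Phi> w)" if "set w = set u" for w
    unfolding \<Phi>_def using c that by (intro annot_concat) auto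
  have \<rho>: "\<rho> (B a t) = t" if "t < r" for a t
    using that by (simp add: \<rho>_def B_def blk_mod)
  have dec: "dec (B a c) = a" for a
    using unblk_blk[of "c - 1" r a] c by (simp add: dec_def B_def)
  have U: "concat (map \<Phi> u) = concat (map (\<lambda>a. map (B a) [0..<r]) (zw r m))"
  proof -
    have "concat (map \<Phi> u) = annot r c 0 (zw r (Suc m))"
      using annot[of u] Suc.prems by simp
    also have "\<dots> = concat (map (\<lambda>a. annot r c 0 (map (blk r a) [0..<r])) (zw r m))"
      unfolding zw_Suc[OF r] using c by (intro annot_concat) (auto simp: hd_map blk_mod)
    also have "\<dots> = concat (map (\<lambda>a. map (B a) [0..<r]) (zw r m))"
      using c by (subst annot_map_upt) (auto simp: blk_mod B_def intro!: arg_cong[where f = concat])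
    finally show ?thesis .
  qed
  have kid: "kid (concat (map \<Phi> u)) (concat (map \<Phi> v))"
    using assms(1) by (rule kid_morphism)
  have \<Psi>: "\<Psi> (concat (map \<Phi> w)) = concat (map (\<lambda>x. \<Psi> (\<Phi> x)) w)" for w
    by (simp add: \<Psi>_def filter_concat map_concat comp_def)
  have "\<Psi> (concat (map \<Phi> u)) = zw r m"
  proof -
    have "filter (\<lambda>z. \<rho> z = c) (concat (map (\<lambda>b. map b [0..<r]) (map B (zw r m))))
        = concat (map (\<lambda>b. map b (filter (\<lambda>i. i = c) [0..<r])) (map B (zw r m)))"
      using \<rho> by (intro filter_blocks[where P = "\<lambda>i. i = c"]) auto
    then show ?thesis
      by (simp add: \<Psi>_def U comp_def filter_upt_one c dec)
  qed
  \<comment> \<open>Sending \<open>x\<close> to \<open>\<Psi> (\<Phi> x)\<close> is the substitution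
    to which the induction hypothesis applies.\<close>
  then have "\<Psi> (concat (map \<Phi> v)) = zw r m"
    unfolding \<Psi> by (rule Suc.IH)
  then have "concat (map \<Phi> v) = concat (map \<Phi> u)"
    using kid_blocks_rigid[of c r \<rho> B dec, OF c(2) \<rho> dec U kid] unfolding \<Psi>_def by blast
  then have "concat (map \<theta> v) = concat (map \<theta> u)"
    using annot[of v] annot[of u] kid_set[OF assms(1)]
      map_fst_annot[of r c 0 "concat (map \<theta> u)"] map_fst_annot[of r c 0 "concat (map \<theta> v)"] by simp
  then show ?case using Suc.prems by simp
qed


section \<open>The model inside the Kauffman monoid\<close>

fun uf :: "('v \<times> 'v) list \<Rightarrow> 'v \<Rightarrow> 'v" where
  "uf [] v = v"
| "uf ((a, b) # es) v = (if uf es v = uf es a then uf es b else uf es v)"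

lemma rtrancl_insert_sym:
  assumes "sym R"
  shows "(x, y) \<in> (insert (a, b) (insert (b, a) R))\<^sup>* \<longleftrightarrow>
    (x, y) \<in> R\<^sup>* \<or> (x, a) \<in> R\<^sup>* \<and> (b, y) \<in> R\<^sup>* \<or> (x, b) \<in> R\<^sup>* \<and> (a, y) \<in> R\<^sup>*"
proof -
  have "sym (R\<^sup>*)" using assms by (rule sym_rtrancl)
  then show ?thesis
    unfolding rtrancl_insert by (auto dest: symD intro: rtrancl_trans)
qed

lemma rtrancl_iff_uf:
  "(x, y) \<in> (set es \<union> (set es)\<inverse>)\<^sup>* \<longleftrightarrow> uf es x = uf es y"
proof (induction es arbitrary: x y)
  case (Cons e es)
  obtain a b where e: "e = (a, b)" by (cases e)
  have "set (e # es) \<union> (set (e # es))\<inverse> = insert (a, b) (insert (b, a) (set es \<union> (set es)\<inverse>))"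
    by (auto simp: e)
  moreover have "sym (set es \<union> (set es)\<inverse>)" by (simp add: sym_Un_converse)
  ultimately show ?case
    using Cons.IH by (auto simp: rtrancl_insert_sym e)
qed simp

definition edges :: "(point \<Rightarrow> nat \<times> nat) \<Rightarrow> (point \<times> point) list \<Rightarrow> ((nat \<times> nat) \<times> (nat \<times> nat)) list" where
  "edges h ps = map (\<lambda>(x, y). (h x, h y)) ps"

lemma doubleton_in_image:
  "{x, y} \<in> (\<lambda>(x, y). {x, y}) ` S \<longleftrightarrow> (x, y) \<in> S \<or> (y, x) \<in> S" for x y :: 'a
  by (auto simp: doubleton_eq_iff image_iff split: prod.splits intro: bexI[of _ "(x, y)"] bexI[of _ "(y, x)"])

lemma doubletons_symmetric:
  fixes P :: "'a \<Rightarrow> 'a \<Rightarrow> bool"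
  assumes "\<And>x y. R x y \<Longrightarrow> R y x"
  shows "{{x, y} | x y. P x y \<and> R x y} = {{x, y} | x y. (P x y \<or> P y x) \<and> R x y}"
proof -
  have "{x, y} = {y, x}" for x y :: 'a by (rule insert_commute)
  then show ?thesis using assms by blast
qed

lemma doubletons_image:
  "(\<lambda>(x, y). {x, y}) ` {p \<in> S. case p of (x, y) \<Rightarrow> R x y} = {{x, y} | x y. (x, y) \<in> S \<and> R x y}" for S :: "('a \<times> 'a) set"
  by (auto simp: image_iff)

lemma image_doubletons:
  fixes h :: "'a \<Rightarrow> 'b"
  shows "{(h x, h y) | x y. {x, y} \<in> (\<lambda>(x, y). {x, y}) ` S}
    = (\<lambda>(x, y). (h x, h y)) ` S \<union> ((\<lambda>(x, y). (h x, h y)) ` S)\<inverse>"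
  unfolding doubleton_in_image by (auto simp: image_iff)

lemma wgraph_edges:
  fixes ps qs
  defines "es \<equiv> edges sig ps @ edges tau qs"
  shows "wgraph ((\<lambda>(x, y). {x, y}) ` set ps) ((\<lambda>(x, y). {x, y}) ` set qs) = set es \<union> (set es)\<inverse>"
  unfolding wgraph_def image_doubletons es_def edges_def set_append set_map converse_Un
  by (simp only: Un_ac)

definition ptl :: "point list" where
  "ptl = [(1, False), (2, False), (3, False), (1, True), (2, True), (3, True)]"

definition vtl :: "(nat \<times> nat) list" where
  "vtl = [(1, 0), (2, 0), (3, 0), (1, 1), (2, 1), (3, 1), (1, 2), (2, 2), (3, 2)]"

text \<open>Every pair of naturals counts as a vertex; this confines the component of a vertex in
  \<open>vtl\<close> to \<open>vtl\<close>, so components can be tested on a finite list.\<close>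

lemma uf_vtl:
  assumes "set es \<subseteq> set vtl \<times> set vtl"
  shows "uf es v \<in> set vtl \<longleftrightarrow> v \<in> set vtl"
  using assms
proof (induction es arbitrary: v)
  case (Cons e es)
  then have *: "uf es v \<in> set vtl \<longleftrightarrow> v \<in> set vtl" for v by simp
  obtain a b where "e = (a, b)" "a \<in> set vtl" "b \<in> set vtl" using Cons.prems by auto
  then show ?case using *[of v] *[of a] *[of b] by auto
qed simp

text \<open>The recursion of \<open>uf\<close> branches; tabulating it keeps evaluation linear.\<close>

definition relabel :: "nat \<times> nat \<Rightarrow> nat \<times> nat \<Rightarrow> ((nat \<times> nat) \<times> (nat \<times> nat)) list \<Rightarrow> ((nat \<times> nat) \<times> (nat \<times> nat)) list" where
  "relabel c d t = map (\<lambda>(v, l). (v, if l = c then d else l)) t"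

definition link :: "nat \<times> nat \<Rightarrow> nat \<times> nat \<Rightarrow> ((nat \<times> nat) \<times> (nat \<times> nat)) list \<Rightarrow> ((nat \<times> nat) \<times> (nat \<times> nat)) list" where
  "link a b t = relabel (the (map_of t a)) (the (map_of t b)) t"

fun uftab :: "((nat \<times> nat) \<times> (nat \<times> nat)) list \<Rightarrow> ((nat \<times> nat) \<times> (nat \<times> nat)) list" where
  "uftab [] = map (\<lambda>v. (v, v)) vtl"
| "uftab ((a, b) # es) = link a b (uftab es)"

lemma map_of_graph: "v \<in> set vs \<Longrightarrow> map_of (map (\<lambda>v. (v, f v)) vs) v = Some (f v)"
  by (induction vs) auto

lemma uftab:
  assumes "set es \<subseteq> set vtl \<times> set vtl"
  shows "uftab es = map (\<lambda>v. (v, uf es v)) vtl"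
  using assms
proof (induction es)
  case (Cons e es)
  obtain a b where e: "e = (a, b)" "a \<in> set vtl" "b \<in> set vtl" using Cons.prems by auto
  have "uftab es = map (\<lambda>v. (v, uf es v)) vtl" using Cons by simp
  then show ?case
    using e by (simp add: link_def relabel_def map_of_graph)
qed simp

text \<open>Order and orientation match those of \<open>kedges\<close>, so that filtering returns
  the very list of a diagram.\<close>

definition pairs :: "(point \<times> point) list" where
  "pairs = [((1, False), (2, False)), ((1, False), (3, False)), ((2, False), (3, False)),
     ((1, True), (2, True)), ((1, True), (3, True)), ((2, True), (3, True)),
     ((1, False), (1, True)), ((1, False), (2, True)), ((1, False), (3, True)),
     ((2, False), (1, True)), ((2, False), (2, True)), ((2, False), (3, True)),
     ((3, False), (1, True)), ((3, False), (2, True)), ((3, False), (3, True))]"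

lemma pairs: "x \<in> set ptl \<and> y \<in> set ptl \<and> x \<noteq> y \<longleftrightarrow> (x, y) \<in> set pairs \<or> (y, x) \<in> set pairs"
proof -
  have "(\<forall>x\<in>set ptl. \<forall>y\<in>set ptl. x \<noteq> y \<longrightarrow> (x, y) \<in> set pairs \<or> (y, x) \<in> set pairs) \<and>
    (\<forall>(x, y)\<in>set pairs. x \<in> set ptl \<and> y \<in> set ptl \<and> x \<noteq> y)"
    by (simp add: ptl_def pairs_def)
  then show ?thesis by blast
qed

definition wtab :: "((nat \<times> nat) \<times> (nat \<times> nat)) list \<Rightarrow> (point \<times> point) list \<times> nat" where
  "wtab t =
     (filter (\<lambda>(x, y). the (map_of t (outer x)) = the (map_of t (outer y))) pairs,
      length (remdups (map (\<lambda>v. the (map_of t v)) (filter (\<lambda>v. \<forall>(y, l)\<in>set t. the (map_of t v) = l \<longrightarrow> snd y = 1) [(1, 1), (2, 1), (3, 1)]))))"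

definition wtable :: "(point \<times> point) list \<Rightarrow> (point \<times> point) list \<Rightarrow> (point \<times> point) list \<times> nat" where
  "wtable ps qs = wtab (uftab (edges sig ps @ edges tau qs))"

lemma wtable_eq:
  assumes "set es \<subseteq> set vtl \<times> set vtl" "es = edges sig ps @ edges tau qs"
  shows "wtable ps qs =
     (filter (\<lambda>(x, y). uf es (outer x) = uf es (outer y)) pairs,
      length (remdups (map (uf es) (filter (\<lambda>v. \<forall>y\<in>set vtl. uf es v = uf es y \<longrightarrow> snd y = 1) [(1, 1), (2, 1), (3, 1)]))))"
proof -
  have lookup: "the (map_of (uftab es) v) = uf es v" if "v \<in> set vtl" for v
    using that by (simp add: uftab[OF assms(1)] map_of_graph)
  have outer: "\<forall>(x, y)\<in>set pairs. outer x \<in> set vtl \<and> outer y \<in> set vtl"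
    by (simp add: pairs_def vtl_def outer_def)
  have mid: "set [(1, 1), (2, 1), (3, 1)] \<subseteq> set vtl" by (simp add: vtl_def)
  have "map (\<lambda>v. the (map_of (uftab es) v)) (filter (\<lambda>v. \<forall>(y, l)\<in>set (uftab es). the (map_of (uftab es) v) = l \<longrightarrow> snd y = 1) ms)
    = map (uf es) (filter (\<lambda>v. \<forall>y\<in>set vtl. uf es v = uf es y \<longrightarrow> snd y = 1) ms)" if "set ms \<subseteq> set vtl" for ms
    using that
  proof (induction ms)
    case (Cons v ms)
    have "(\<forall>(y, l)\<in>set (uftab es). uf es v = l \<longrightarrow> snd y = 1) \<longleftrightarrow> (\<forall>y\<in>set vtl. uf es v = uf es y \<longrightarrow> snd y = 1)"
      by (simp add: uftab[OF assms(1)])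
    then show ?case using Cons lookup[of v] by simp
  qed simp
  note * = this[OF mid]
  have "(case p of (x, y) \<Rightarrow> the (map_of (uftab es) (outer x)) = the (map_of (uftab es) (outer y)))
    = (case p of (x, y) \<Rightarrow> uf es (outer x) = uf es (outer y))" if "p \<in> set pairs" for p
    using outer[rule_format, OF that] lookup by (cases p) (simp only: case_prod_conv)
  then have **: "filter (\<lambda>(x, y). the (map_of (uftab es) (outer x)) = the (map_of (uftab es) (outer y))) pairs
    = filter (\<lambda>(x, y). uf es (outer x) = uf es (outer y)) pairs"
    by (rule filter_cong[OF HOL.refl])
  show ?thesis
    unfolding wtable_def assms(2)[symmetric] wtab_def * ** ..
qed

lemma wmult_table:
  assumes "set ps \<subseteq> set ptl \<times> set ptl" "set qs \<subseteq> set ptl \<times> set ptl"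
  shows "wmult 3 ((\<lambda>(x, y). {x, y}) ` set ps, d) ((\<lambda>(x, y). {x, y}) ` set qs, e)
    = ((\<lambda>(x, y). {x, y}) ` set (fst (wtable ps qs)), d + e + snd (wtable ps qs))"
proof -
  define es where "es = edges sig ps @ edges tau qs"
  define C where "C = wconn ((\<lambda>(x, y). {x, y}) ` set ps) ((\<lambda>(x, y). {x, y}) ` set qs)"
  have C: "(x, y) \<in> C \<longleftrightarrow> uf es x = uf es y" for x y
    unfolding C_def wconn_def es_def wgraph_edges by (rule rtrancl_iff_uf)
  have "set es \<subseteq> set vtl \<times> set vtl"
  proof -
    have "sig x \<in> set vtl \<and> tau x \<in> set vtl" if "x \<in> set ptl" for x
      using that by (auto simp: ptl_def vtl_def sig_def tau_def)
    then show ?thesis using assms by (auto simp: es_def edges_def)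
  qed
  note vtl = uf_vtl[OF this] and wtable = wtable_eq[OF this es_def]
  have pts: "pts 3 = set ptl"
    by (auto simp: pts_def ptl_def)
  have middle: "middle 3 = set [(1, 1), (2, 1), (3, 1)]"
    by (auto simp: middle_def)
  have sub: "C `` {v} \<subseteq> middle 3 \<longleftrightarrow> (\<forall>y\<in>set vtl. uf es v = uf es y \<longrightarrow> snd y = 1)" if "v \<in> middle 3" for v
  proof -
    have "v \<in> set vtl" using that by (auto simp: middle vtl_def)
    then have "y \<in> set vtl" if "uf es v = uf es y" for y
      using that vtl[of v] vtl[of y] by simp
    moreover have "\<forall>y\<in>set vtl. y \<in> middle 3 \<longleftrightarrow> snd y = 1"
      by (simp add: middle_def vtl_def)
    ultimately show ?thesis
      unfolding subset_iff Image_singleton_iff C by blast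
  qed
  \<comment> \<open>Components correspond bijectively to labels, a component going to the label of
    any of its members.\<close>
  have "card ((\<lambda>v. C `` {v}) ` A) = card (uf es ` A)" for A
  proof (rule bij_betw_same_card[of "\<lambda>B. uf es (SOME v. v \<in> B)"])
    have *: "uf es (SOME w. w \<in> C `` {v}) = uf es v" for v
      using someI[of "\<lambda>w. w \<in> C `` {v}" v] C by simp
    have "C `` {v} = C `` {w}" if "uf es v = uf es w" for v w
      unfolding set_eq_iff Image_singleton_iff C using that by simp
    then show "bij_betw (\<lambda>B. uf es (SOME v. v \<in> B)) ((\<lambda>v. C `` {v}) ` A) (uf es ` A)"
      unfolding bij_betw_def inj_on_def ball_simps image_image * by blast
  qed
  moreover have "{v \<in> middle 3. C `` {v} \<subseteq> middle 3}
      = set (filter (\<lambda>v. \<forall>y\<in>set vtl. uf es v = uf es y \<longrightarrow> snd y = 1) [(1, 1), (2, 1), (3, 1)])"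
    unfolding set_filter middle[symmetric] using sub by blast
  ultimately have "card ((\<lambda>v. C `` {v}) ` {v \<in> middle 3. C `` {v} \<subseteq> middle 3}) = snd (wtable ps qs)"
    unfolding wtable by (simp only: snd_conv set_map length_remdups_card_conv)
  moreover have "{{x, y} | x y. x \<in> pts 3 \<and> y \<in> pts 3 \<and> x \<noteq> y \<and> (outer x, outer y) \<in> C}
      = (\<lambda>(x, y). {x, y}) ` set (fst (wtable ps qs))"
  proof -
    have "(\<lambda>(x, y). {x, y}) ` set (fst (wtable ps qs)) = {{x, y} | x y. (x, y) \<in> set pairs \<and> (outer x, outer y) \<in> C}"
      unfolding wtable C fst_conv set_filter by (rule doubletons_image)
    also have "\<dots> = {{x, y} | x y. ((x, y) \<in> set pairs \<or> (y, x) \<in> set pairs) \<and> (outer x, outer y) \<in> C}"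
      by (rule doubletons_symmetric) (simp add: C)
    finally show ?thesis unfolding pts by (simp only: pairs[symmetric] conj_assoc)
  qed
  ultimately show ?thesis
    by (simp add: wmult_def Let_def flip: C_def)
qed

section \<open>Diagrams on three strands\<close>

fun kedges :: "(bool \<times> bool) option \<Rightarrow> (point \<times> point) list" where
  "kedges None = [((1, False), (1, True)), ((2, False), (2, True)), ((3, False), (3, True))]"
| "kedges (Some (i, j)) =
    (if i then [((1, False), (2, False))] else [((2, False), (3, False))]) @
    (if j then [((1, True), (2, True))] else [((2, True), (3, True))]) @
    [((if i then 3 else 1, False), (if j then 3 else 1, True))]"

definition kparts :: "(bool \<times> bool) option \<Rightarrow> point set set" where
  "kparts a = (\<lambda>(x, y). {x, y}) ` set (kedges a)"


text \<open>A finite computation over all 25 products of loop-free diagrams.\<close>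

lemma wtable_kedges:
  "wtable (kedges a) (kedges b) = (kedges (fst (kmul (a, 0) (b, 0))), snd (kmul (a, 0) (b, 0)))"
proof -
  have "\<forall>i j k l. wtable (kedges (Some (i, j))) (kedges (Some (k, l))) = (kedges (Some (i, l)), if j = k then 1 else 0)"
    "\<forall>i j. wtable (kedges (Some (i, j))) (kedges None) = (kedges (Some (i, j)), 0)"
    "\<forall>i j. wtable (kedges None) (kedges (Some (i, j))) = (kedges (Some (i, j)), 0)"
    "wtable (kedges None) (kedges None) = (kedges None, 0)"
    unfolding all_bool_eq
    by (simp_all add: wtable_def wtab_def link_def relabel_def edges_def sig_def tau_def outer_def vtl_def pairs_def)
  then show ?thesis
    by (cases a; cases b) (auto simp del: kedges.simps)
qed

fun kwire :: "kmodel \<Rightarrow> wire" where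
  "kwire (a, d) = (kparts a, d)"

lemma kmul_shift: "kmul (a, d) (b, e) = (fst (kmul (a, 0) (b, 0)), d + e + snd (kmul (a, 0) (b, 0)))"
  by (cases a; cases b) auto

lemma kwire_kmul: "wmult 3 (kwire a) (kwire b) = kwire (kmul a b)"
proof -
  obtain x d y e where ab: "a = (x, d)" "b = (y, e)" by (cases a, cases b)
  have ptl: "set (kedges z) \<subseteq> set ptl \<times> set ptl" for z
    by (cases z rule: kedges.cases) (simp_all add: ptl_def)
  show ?thesis
    unfolding ab kwire.simps kparts_def wmult_table[OF ptl ptl] wtable_kedges
    by (subst kmul_shift) (simp add: kparts_def)
qed

lemma inj_kparts: "kparts a = kparts b \<Longrightarrow> a = b"
proof -
  define f :: "(bool \<times> bool) option \<Rightarrow> bool \<times> bool \<times> bool" where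
    "f a = ({(1, False), (1, True)} \<in> kparts a \<and> {(2, False), (2, True)} \<in> kparts a,
      {(1, False), (2, False)} \<in> kparts a, {(1, True), (2, True)} \<in> kparts a)" for a
  have "f None = (True, False, False)" "f (Some (i, j)) = (False, i, j)" for i j
    by (auto simp: f_def kparts_def doubleton_eq_iff)
  then have "f a = f b \<Longrightarrow> a = b"
    by (cases a; cases b) auto
  then show "kparts a = kparts b \<Longrightarrow> a = b" by (simp add: f_def)
qed

lemma kwire_inject: "kwire a = kwire b \<longleftrightarrow> a = b"
  by (cases a; cases b) (auto dest: inj_kparts)

lemma kwire_None: "kwire (None, d) = (fst (wone 3), d)"
proof -
  have "{1..3} = {1, 2, 3::nat}" by auto
  then show ?thesis by (auto simp: kparts_def wone_def)
qed

lemma kwire_kauff: "kwire a \<in> kauff 3"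
proof -
  have N: "kwire (None, d) \<in> kauff 3" for d
  proof (induction d)
    case 0
    then show ?case unfolding kwire_None using kauff.one[of 3] by (simp add: wone_def)
  next
    case (Suc d)
    have "kwire (None, 1) = circ 3" unfolding kwire_None by (simp add: circ_def)
    then have "kwire (None, 1) \<in> kauff 3" using kauff.circ by simp
    then have "wmult 3 (kwire (None, 1)) (kwire (None, d)) \<in> kauff 3" using Suc by (rule kauff.mult)
    then show ?case by (simp only: kwire_kmul) simp
  qed
  have h: "kwire (Some (True, True), 0) = hook 3 1" "kwire (Some (False, False), 0) = hook 3 2"
  proof -
    have "hook 3 i = ({{(i, False), (Suc i, False)}, {(i, True), (Suc i, True)}}
        \<union> (\<lambda>j. {(j, False), (j, True)}) ` ({1..3} - {i, Suc i}), 0)" for i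
      unfolding hook_def by blast
    moreover have "{1..3} - {1, Suc 1} = {3::nat}" "{1..3} - {2, Suc 2} = {1::nat}" by auto
    ultimately show "kwire (Some (True, True), 0) = hook 3 1" "kwire (Some (False, False), 0) = hook 3 2"
      by (simp_all add: kparts_def numeral_2_eq_2 numeral_3_eq_3 insert_commute)
  qed
  have S: "kwire (Some (i, j), 0) \<in> kauff 3" for i j
  proof -
    have "kwire (Some (i, i), 0) \<in> kauff 3" for i
      using kauff.hook[of 1 3] kauff.hook[of 2 3] h by (cases i) auto
    from kauff.mult[OF this this, of i j] have "kwire (kmul (Some (i, i), 0) (Some (j, j), 0)) \<in> kauff 3"
      by (simp only: kwire_kmul)
    \<comment> \<open>For \<open>i \<noteq> j\<close> the product of the two hooks has no loop; for
      \<open>i = j\<close> it would gain one, so the hook itself is taken.\<close>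
    then show ?thesis by (cases "i = j") (use \<open>\<And>i. kwire (Some (i, i), 0) \<in> kauff 3\<close> in auto)
  qed
  obtain x d where a: "a = (x, d)" by (cases a)
  show ?thesis
  proof (cases x)
    case None
    then show ?thesis using N a by simp
  next
    case (Some y)
    obtain i j where y: "y = (i, j)" by (cases y)
    have "kwire (kmul (None, d) (Some (i, j), 0)) \<in> kauff 3"
      using kauff.mult[OF N S] by (simp only: kwire_kmul)
    then show ?thesis using a Some y by simp
  qed
qed

fun kstar :: "kmodel \<Rightarrow> kmodel" where
  "kstar (None, d) = (None, d)"
| "kstar (Some (i, j), d) = (Some (j, i), d)"

lemma kstar_kstar [simp]: "kstar (kstar a) = a"
  by (cases a rule: kstar.cases) auto

lemma kstar_kmul: "kstar (kmul a b) = kmul (kstar b) (kstar a)"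
  by (cases a rule: kstar.cases; cases b rule: kstar.cases) auto

lemma kwire_kstar: "wstar (kwire a) = kwire (kstar a)"
proof (cases a rule: kstar.cases)
  case (2 i j d)
  then show ?thesis by (cases i; cases j) (simp_all add: wstar_def kparts_def insert_commute)
qed (simp add: wstar_def kparts_def insert_commute)

section \<open>Words over the wire monoid\<close>

text \<open>Left multiplication by the letters, the last one first, matching the nesting of
  \<open>sg_eval\<close>.\<close>

definition wact :: "nat \<Rightarrow> (nat \<Rightarrow> wire) \<Rightarrow> nat list \<Rightarrow> wire \<Rightarrow> wire" where
  "wact n f p z = foldr (\<lambda>x. wmult n (f x)) p z"

lemma wact_simps [simp]: "wact n f [] z = z" "wact n f (x # p) z = wmult n (f x) (wact n f p z)"
  by (simp_all add: wact_def)

lemma wact_append: "wact n f (p @ q) z = wact n f p (wact n f q z)"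
  by (simp add: wact_def)

lemma sg_eval_append: "t \<noteq> [] \<Longrightarrow> sg_eval (wmult n) f (p @ t) = wact n f p (sg_eval (wmult n) f t)"
proof (induction p)
  case (Cons x p)
  then obtain y ys where "p @ t = y # ys" by (cases "p @ t") auto
  then show ?case using Cons by simp
qed simp

lemma fst_wmult_cong: "fst a = fst a' \<Longrightarrow> fst b = fst b' \<Longrightarrow> fst (wmult n a b) = fst (wmult n a' b')"
  by (simp add: wmult_def Let_def)

lemma wmult_shift: "wmult n a (\<pi>, d) = (fst (wmult n a (\<pi>, 0)), d + snd (wmult n a (\<pi>, 0)))"
  by (simp add: wmult_def Let_def)

text \<open>Partitions evolve independently of loop counts, and loops already present are only
  carried along.\<close>

lemma wact_shift: "wact n f p (\<pi>, d) = (fst (wact n f p (\<pi>, 0)), d + snd (wact n f p (\<pi>, 0)))"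
proof (induction p)
  case (Cons x p)
  let ?w = "wact n f p (\<pi>, 0)"
  have "wact n f (x # p) (\<pi>, d) = wmult n (f x) (fst ?w, d + snd ?w)"
    using Cons by simp
  also have "\<dots> = (fst (wmult n (f x) (fst ?w, 0)), d + snd ?w + snd (wmult n (f x) (fst ?w, 0)))"
    by (rule wmult_shift)
  also have "\<dots> = (fst (wmult n (f x) ?w), d + snd (wmult n (f x) ?w))"
    using wmult_shift[of n "f x" "fst ?w" "snd ?w"] by (simp only: prod.collapse) simp
  finally show ?case by simp
qed simp

text \<open>A crude finite superset of the pair partitions, closed under the action for arbitrary
  arguments.\<close>

definition states :: "nat \<Rightarrow> point set set set" where
  "states n = Pow (Pow (pts n))"

lemma finite_states: "finite (states n)"
  by (simp add: states_def pts_def)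

lemma fst_wmult_states: "fst (wmult n a b) \<in> states n"
  by (auto simp: wmult_def Let_def states_def)

lemma fst_wact_states: "fst z \<in> states n \<Longrightarrow> fst (wact n f p z) \<in> states n"
  by (cases p) (simp_all add: fst_wmult_states)

lemma fst_wact_cong:
  "\<forall>x\<in>set p. fst (f x) = fst (g x) \<Longrightarrow> fst z = fst z' \<Longrightarrow> fst (wact n f p z) = fst (wact n g p z')"
proof (induction p)
  case (Cons x p)
  then show ?case using fst_wmult_cong[of "f x" "g x"] by simp
qed simp

text \<open>All assignments to the letters below \<open>R\<close> are treated at once, so that finitely many actions
  suffice as colours for Ramsey's theorem.\<close>

definition action :: "nat \<Rightarrow> nat \<Rightarrow> nat list \<Rightarrow> (nat \<Rightarrow> point set set) \<times> point set set \<Rightarrow> point set set" where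
  "action n R p = (\<lambda>(g, \<pi>)\<in>({..<R} \<rightarrow>\<^sub>E states n) \<times> states n. fst (wact n (\<lambda>x. (g x, 0)) p (\<pi>, 0)))"

lemma action_in: "action n R p \<in> (({..<R} \<rightarrow>\<^sub>E states n) \<times> states n) \<rightarrow>\<^sub>E states n"
  by (auto simp: action_def intro: fst_wact_states)

lemma finite_actions: "finite ((({..<R::nat} \<rightarrow>\<^sub>E states n) \<times> states n) \<rightarrow>\<^sub>E states n)"
  by (intro finite_PiE finite_cartesian_product finite_states finite_lessThan)

lemma fst_wact_action:
  assumes "set p \<subseteq> {..<R}" "\<And>x. fst (f x) \<in> states n" "fst z \<in> states n"
  shows "fst (wact n f p z) = action n R p (restrict (\<lambda>x. fst (f x)) {..<R}, fst z)"
proof -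
  have "restrict (\<lambda>x. fst (f x)) {..<R} \<in> {..<R} \<rightarrow>\<^sub>E states n" using assms by auto
  then have "action n R p (restrict (\<lambda>x. fst (f x)) {..<R}, fst z)
    = fst (wact n (\<lambda>x. (restrict (\<lambda>x. fst (f x)) {..<R} x, 0)) p (fst z, 0))"
    using assms unfolding action_def by simp
  also have "\<dots> = fst (wact n f p z)"
    using assms by (intro fst_wact_cong) auto
  finally show ?thesis by simp
qed

text \<open>A word acting as an idempotent returns the state that it has reached, so later factors with
  the same action contribute numbers of loops that do not depend on their order.\<close>

lemma sg_eval_swap:
  assumes act: "action n R b = action n R a" "action n R c = action n R a" "action n R (a @ b) = action n R a"
    and R: "set (a @ b @ c) \<subseteq> {..<R}"
    and f: "\<And>x. f x \<in> wire_set n" and t: "t \<noteq> []"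
  shows "sg_eval (wmult n) f (s @ a @ b @ c @ t) = sg_eval (wmult n) f (s @ b @ a @ c @ t)"
proof -
  have fst: "fst (f x) \<in> states n" for x
    using f[of x] by (auto simp: wire_set_def states_def partition_on_def)
  define g where "g = restrict (\<lambda>x. fst (f x)) {..<R}"
  have act': "fst (wact n f p z) = action n R p (g, fst z)" if "set p \<subseteq> {..<R}" "fst z \<in> states n" for p z
    unfolding g_def by (rule fst_wact_action[OF that(1) fst that(2)])
  obtain \<pi> d where z: "sg_eval (wmult n) f t = (\<pi>, d)" by force
  have "fst (sg_eval (wmult n) f t) \<in> states n"
    using t fst by (cases "(wmult n, f, t)" rule: sg_eval.cases) (auto simp: fst_wmult_states)
  then have \<pi>: "\<pi> \<in> states n" using z by simp
  define e where "e = action n R a (g, \<pi>)"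
  have e: "fst (wact n f c (\<pi>, d)) = e"
    using act'[of c "(\<pi>, d)"] R \<pi> act by (simp add: e_def)
  have es: "e \<in> states n" using e fst_wact_states \<pi> by fastforce
  \<comment> \<open>Computing the effect of \<open>a @ b\<close> on \<open>\<pi>\<close> in two ways
    shows that \<open>a\<close> fixes \<open>e\<close>; \<open>b\<close> acts in the same
    way.\<close>
  have "e = fst (wact n f (a @ b) (\<pi>, 0))"
    using act'[of "a @ b" "(\<pi>, 0)"] R \<pi> act by (simp add: e_def)
  also have "\<dots> = fst (wact n f a (wact n f b (\<pi>, 0)))" by (simp add: wact_append)
  also have "\<dots> = action n R a (g, fst (wact n f b (\<pi>, 0)))"
    using R \<pi> by (intro act') (auto intro: fst_wact_states)
  also have "fst (wact n f b (\<pi>, 0)) = e"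
    using act'[of b "(\<pi>, 0)"] R \<pi> act by (simp add: e_def)
  finally have ee: "action n R a (g, e) = e" by simp
  have a: "wact n f a (e, k) = (e, k + snd (wact n f a (e, 0)))" for k
    using act'[of a "(e, 0)"] R es ee wact_shift[of n f a e k] by simp
  have b: "wact n f b (e, k) = (e, k + snd (wact n f b (e, 0)))" for k
    using act'[of b "(e, 0)"] R es ee act wact_shift[of n f b e k] by simp
  obtain k where k: "wact n f c (\<pi>, d) = (e, k)" using e by (metis prod.collapse)
  show ?thesis
    using t by (simp add: sg_eval_append wact_append z k a[of k] b[of k]
      a[of "k + snd (wact n f b (e, 0))"] b[of "k + snd (wact n f a (e, 0))"] add_ac)
qed

lemma map_upt_append: "i \<le> j \<Longrightarrow> j \<le> k \<Longrightarrow> map h [i..<j] @ map h [j..<k] = map h [i..<k]"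
  by (metis le_Suc_ex map_append upt_add_eq_append)

text \<open>Commuting words are powers of a common word; as both are nonempty, their product would
  begin with a square.\<close>

lemma xw_upt_not_commute:
  assumes "3 \<le> r" "i < j" "j < k"
  shows "map (xw r) [i..<j] @ map (xw r) [j..<k] \<noteq> map (xw r) [j..<k] @ map (xw r) [i..<j]"
proof
  let ?a = "map (xw r) [i..<j]" and ?b = "map (xw r) [j..<k]"
  assume "?a @ ?b = ?b @ ?a"
  then obtain m m' zs where zs: "concat (replicate m zs) = ?a" "concat (replicate m' zs) = ?b"
    by (metis comm_append_are_replicate)
  have "?a \<noteq> []" "?b \<noteq> []" using assms by auto
  then have "m \<noteq> 0" "m' \<noteq> 0" "zs \<noteq> []"
    using zs concat_replicate_trivial[of m] by (metis concat.simps(1) replicate_0)+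
  then obtain q q' where q: "m = Suc q" "m' = Suc q'" by (metis not0_implies_Suc)
  have "map (xw r) [i..<k] = ?a @ ?b" using assms by (simp add: map_upt_append)
  also have "\<dots> = concat (replicate (m + m') zs)" using zs by (simp add: replicate_add)
  also have "\<dots> = zs @ zs @ concat (replicate (q + q') zs)" using q by simp
  finally have *: "map (xw r) [i..<k] = zs @ zs @ concat (replicate (q + q') zs)" .
  let ?l = "length zs"
  have len: "?l + ?l \<le> k - i" using arg_cong[OF *, of length] by simp
  have "xw r (i + j') = xw r (i + ?l + j')" if "j' < ?l" for j'
  proof -
    have "xw r (i + j') = map (xw r) [i..<k] ! j'" using that len by simp
    also have "\<dots> = map (xw r) [i..<k] ! (?l + j')" unfolding * using that by (simp add: nth_append)
    also have "\<dots> = xw r (i + ?l + j')" using that len by (simp add: add.assoc)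
    finally show ?thesis .
  qed
  then show False using xw_squarefree[OF assms(1), of ?l i] \<open>zs \<noteq> []\<close> by auto
qed

lemma zw_swap:
  assumes r: "3 \<le> r"
  obtains m w where "w \<noteq> zw r m" "w \<noteq> []" "zw r m \<noteq> []"
    "\<And>f. (\<And>x. f x \<in> wire_set n) \<Longrightarrow> sg_eval (wmult n) f (zw r m) = sg_eval (wmult n) f w"
proof -
  define R where "R = r * r"
  define fac where "fac i j = map (xw r) [i..<j]" for i j
  have fac: "fac i j @ fac j k = fac i k" if "i \<le> j" "j \<le> k" for i j k
    unfolding fac_def using that by (rule map_upt_append)
  have sub: "set (fac i j) \<subseteq> {..<R}" for i j
    using r by (auto simp: fac_def R_def intro!: xw_less)
  \<comment> \<open>The finitely many actions are numbered to serve as colours; the pair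
    \<open>i < j\<close> gets the action of the factor from \<open>i\<close> to
    \<open>j\<close>.\<close>
  obtain h :: "_ \<Rightarrow> nat" and N where h: "h ` ((({..<R} \<rightarrow>\<^sub>E states n) \<times> states n) \<rightarrow>\<^sub>E states n) = {i. i < N}"
    "inj_on h ((({..<R} \<rightarrow>\<^sub>E states n) \<times> states n) \<rightarrow>\<^sub>E states n)"
    using finite_imp_inj_to_nat_seg[OF finite_actions[of R n]] by blast
  define col where "col X = h (action n R (fac (Min X) (Max X)))" for X
  have "\<forall>x\<in>UNIV. \<forall>y\<in>UNIV. x \<noteq> y \<longrightarrow> col {x, y} < N"
    using h(1) action_in unfolding col_def by blast
  then obtain Y k where Y: "infinite Y" "\<forall>x\<in>Y. \<forall>y\<in>Y. x \<noteq> y \<longrightarrow> col {x, y} = k"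
    using Ramsey2[of "UNIV :: nat set" col N] by auto
  have act: "action n R (fac i j) = action n R (fac i' j')"
    if "i \<in> Y" "j \<in> Y" "i' \<in> Y" "j' \<in> Y" "i < j" "i' < j'" for i j i' j'
  proof -
    have "col {i, j} = col {i', j'}" using Y that by auto
    then have "h (action n R (fac i j)) = h (action n R (fac i' j'))"
      using that by (simp add: col_def)
    then show ?thesis using h(2) action_in by (meson inj_onD)
  qed
  obtain i where i: "i \<in> Y" using Y(1) by fastforce
  obtain j where j: "j \<in> Y" "i < j" using Y(1) by (meson infinite_nat_iff_unbounded)
  obtain k where k: "k \<in> Y" "j < k" using Y(1) by (meson infinite_nat_iff_unbounded)
  obtain l where l: "l \<in> Y" "k < l" using Y(1) by (meson infinite_nat_iff_unbounded)
  \<comment> \<open>The strict bound leaves \<open>?t\<close> nonempty, and its value is the state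
    on which the factors before it act.\<close>
  obtain m where m: "l < r ^ m" using r power_gt_expt[of r l] by auto
  let ?s = "fac 0 i" and ?a = "fac i j" and ?b = "fac j k" and ?c = "fac k l" and ?t = "fac l (r ^ m)"
  have t: "?t \<noteq> []" using m r by (simp add: fac_def)
  have zw: "zw r m = ?s @ ?a @ ?b @ ?c @ ?t"
    using j k l m by (simp add: fac) (simp add: fac_def zw_def)
  show ?thesis
  proof (rule that)
    show "?s @ ?b @ ?a @ ?c @ ?t \<noteq> zw r m"
      using xw_upt_not_commute[OF r j(2) k(2)] unfolding zw fac_def append_assoc[symmetric] by auto
    show "?s @ ?b @ ?a @ ?c @ ?t \<noteq> []" "zw r m \<noteq> []" using t zw by auto
    show "sg_eval (wmult n) f (zw r m) = sg_eval (wmult n) f (?s @ ?b @ ?a @ ?c @ ?t)"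
      if "\<And>x. f x \<in> wire_set n" for f
      unfolding zw
    proof (rule sg_eval_swap[where R = R])
      show "action n R ?b = action n R ?a" "action n R ?c = action n R ?a" "action n R (?a @ ?b) = action n R ?a"
        using i j k l by (auto simp: fac intro!: act)
      show "set (?a @ ?b @ ?c) \<subseteq> {..<R}" using sub by simp
    qed (use that t in auto)
  qed
qed

section \<open>Derivations\<close>

lemma sg_eval_kwire: "u \<noteq> [] \<Longrightarrow> sg_eval (wmult 3) (\<lambda>x. kwire (g x)) u = kwire (keval g u)"
  by (induction u rule: induct_list012) (simp_all add: kwire_kmul)

lemma sg_Id_kauff_kid:
  assumes "(u, v) \<in> sg_Id (kauff 3) (wmult 3)"
  shows "kid u v"
  unfolding kid_def
proof
  fix g
  have uv: "u \<noteq> []" "v \<noteq> []" using assms by (auto simp: sg_Id_def sg_ids_def)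
  have "sg_eval (wmult 3) (\<lambda>x. kwire (g x)) u = sg_eval (wmult 3) (\<lambda>x. kwire (g x)) v"
    using assms kwire_kauff by (simp add: sg_Id_def)
  then show "keval g u = keval g v"
    by (simp only: sg_eval_kwire[OF uv(1)] sg_eval_kwire[OF uv(2)] kwire_inject)
qed

text \<open>Two fresh end letters, mapped to \<open>s\<close> and \<open>t\<close>, absorb the
  context; they account for 4 in place of 2.\<close>

lemma zw_isolated_context:
  fixes u v :: "'a list"
  assumes "kid u v" "card (set u) + 4 \<le> r" "s @ concat (map \<theta> u) @ t = zw r m"
  shows "s @ concat (map \<theta> v) @ t = zw r m"
proof -
  define ctx :: "'a list \<Rightarrow> ('a + bool) list" where
    "ctx w = [Inr False] @ map Inl w @ [Inr True]" for w
  define \<theta>' where "\<theta>' = case_sum \<theta> (\<lambda>b. if b then t else s)"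
  have \<theta>': "concat (map \<theta>' (ctx w)) = s @ concat (map \<theta> w) @ t" for w
    by (simp add: ctx_def \<theta>'_def comp_def)
  have "kid (ctx u) (ctx v)"
    unfolding ctx_def by (intro kid_context kid_map assms(1))
  moreover have "card (set (ctx u)) + 2 \<le> r"
  proof -
    have "set (ctx u) = {Inr False, Inr True} \<union> Inl ` set u" by (auto simp: ctx_def)
    then have "card (set (ctx u)) \<le> card {Inr False, Inr True :: 'a + bool} + card (Inl ` set u :: ('a + bool) set)"
      by (simp only: card_Un_le)
    also have "\<dots> \<le> 2 + card (set u)"
      by (simp add: card_image)
    finally show ?thesis using assms(2) by simp
  qed
  ultimately show ?thesis
    using zw_isolated[of "ctx u" "ctx v" r \<theta>' m] assms(3) by (simp add: \<theta>')
qed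

lemma sg_subst_append: "sg_subst th (u @ v) = sg_subst th u @ sg_subst th v"
  by (simp add: sg_subst_def)

lemma sg_subst_sg_subst: "sg_subst th (sg_subst th' u) = sg_subst (\<lambda>x. sg_subst th (th' x)) u"
  by (induction u) (simp_all add: sg_subst_def)

text \<open>The claim ranges over all contexts and substitutions, so the substitution and
  multiplication rules merely change \<open>th\<close>, \<open>s\<close> and
  \<open>t\<close>.\<close>

lemma sg_deriv_zw:
  assumes S: "S \<subseteq> sg_Id (kauff 3) (wmult 3)" and r: "\<forall>(u, v)\<in>S. card (set u) + 4 \<le> r \<and> card (set v) + 4 \<le> r"
    and "sg_deriv S (u, v)"
  shows "s @ sg_subst th u @ t = zw r m \<longleftrightarrow> s @ sg_subst th v @ t = zw r m"
  using assms(3)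
proof (induction "(u, v)" arbitrary: u v s t th rule: sg_deriv.induct)
  case (ax u v)
  then have "kid u v" "kid v u" using S by (auto intro: sg_Id_kauff_kid kid_sym)
  moreover have "card (set u) + 4 \<le> r" "card (set v) + 4 \<le> r" using r ax by auto
  ultimately show ?case unfolding sg_subst_def using zw_isolated_context by metis
next
  case (subst u v th')
  then show ?case by (simp add: sg_subst_sg_subst)
next
  case (left u v w)
  then show ?case using left(2)[of "s @ sg_subst th w"] by (simp add: sg_subst_append)
next
  case (right u v w)
  then show ?case using right(2)[of s th "sg_subst th w @ t"] by (simp add: sg_subst_append)
qed auto

definition var_bound :: "('a list \<times> 'a list) set \<Rightarrow> nat" where
  "var_bound S = (\<Sum>(u, v)\<in>S. card (set u) + card (set v)) + 4"

lemma var_bound: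
  assumes "finite S"
  shows "\<forall>(u, v)\<in>S. card (set u) + 4 \<le> var_bound S \<and> card (set v) + 4 \<le> var_bound S" "3 \<le> var_bound S"
proof -
  have "card (set u) + card (set v) \<le> (\<Sum>(u, v)\<in>S. card (set u) + card (set v))" if "(u, v) \<in> S" for u v
    using member_le_sum[of "(u, v)" S "\<lambda>(u, v). card (set u) + card (set v)"] that assms by auto
  then show "\<forall>(u, v)\<in>S. card (set u) + 4 \<le> var_bound S \<and> card (set v) + 4 \<le> var_bound S" "3 \<le> var_bound S"
    unfolding var_bound_def by (auto simp: add_increasing2 split: prod.splits) (metis add_leD1 add_leD2)+
qed

lemma sg_not_finitely_based:
  assumes W: "sg_Id (wire_set n) (wmult n) \<subseteq> T" and K: "T \<subseteq> sg_Id (kauff 3) (wmult 3)"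
  shows "\<not> sg_finitely_based T"
proof
  assume "sg_finitely_based T"
  then obtain S where S: "finite S" "{p. sg_deriv S p} = T" by (auto simp: sg_finitely_based_def)
  obtain m w where w: "w \<noteq> zw (var_bound S) m" "w \<noteq> []" "zw (var_bound S) m \<noteq> []"
    "\<And>f. (\<And>x. f x \<in> wire_set n) \<Longrightarrow> sg_eval (wmult n) f (zw (var_bound S) m) = sg_eval (wmult n) f w"
    using zw_swap[OF var_bound(2)[OF S(1)], of n] by metis
  \<comment> \<open>The swapped word gives an identity of the wire monoid, hence of
    \<open>T\<close>, that no derivation from \<open>S\<close> can reach.\<close>
  have "(zw (var_bound S) m, w) \<in> sg_Id (wire_set n) (wmult n)"
    using w by (auto simp: sg_Id_def sg_ids_def)
  then have "sg_deriv S (zw (var_bound S) m, w)" using W S by auto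
  moreover have "S \<subseteq> sg_Id (kauff 3) (wmult 3)" using K S sg_deriv.ax by blast
  moreover have "sg_subst (\<lambda>x. [x]) u = u" for u by (simp add: sg_subst_def)
  ultimately have "zw (var_bound S) m = zw (var_bound S) m \<longleftrightarrow> w = zw (var_bound S) m"
    using sg_deriv_zw[of S "var_bound S" "zw (var_bound S) m" w "[]" "\<lambda>x. [x]" "[]" m] var_bound(1)[OF S(1)]
    by simp
  then show False using w by simp
qed

section \<open>Involution words\<close>

definition pos :: "nat list \<Rightarrow> iword" where
  "pos w = map (\<lambda>x. (x, False)) w"

lemma inv_eval_pos: "inv_eval m st f (pos u) = sg_eval m f u"
proof (induction u rule: induct_list012)
  case (3 x y u)
  then show ?case by (simp add: pos_def letter_val_def)
qed (simp_all add: pos_def letter_val_def)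

definition kletter :: "(nat \<Rightarrow> kmodel) \<Rightarrow> nat \<times> bool \<Rightarrow> kmodel" where
  "kletter f a = (if snd a then kstar (f (fst a)) else f (fst a))"

lemma inv_eval_kwire:
  "u \<noteq> [] \<Longrightarrow> inv_eval (wmult 3) wstar (\<lambda>x. kwire (f x)) u = kwire (keval (kletter f) u)"
proof -
  have "letter_val wstar (\<lambda>x. kwire (f x)) a = kwire (kletter f a)" for a
    by (simp add: letter_val_def kletter_def kwire_kstar)
  then show "u \<noteq> [] \<Longrightarrow> ?thesis"
    by (induction u rule: induct_list012) (simp_all add: kwire_kmul)
qed

definition ikid :: "iword \<Rightarrow> iword \<Rightarrow> bool" where
  "ikid u v \<longleftrightarrow> (\<forall>f. keval (kletter f) u = keval (kletter f) v)"

lemma inv_Id_kauff_ikid: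
  assumes "(u, v) \<in> inv_Id (kauff 3) (wmult 3) wstar"
  shows "ikid u v"
  unfolding ikid_def
proof
  fix f
  have uv: "u \<noteq> []" "v \<noteq> []" using assms by (auto simp: inv_Id_def inv_ids_def)
  have "inv_eval (wmult 3) wstar (\<lambda>x. kwire (f x)) u = inv_eval (wmult 3) wstar (\<lambda>x. kwire (f x)) v"
    using assms kwire_kauff by (simp add: inv_Id_def)
  then show "keval (kletter f) u = keval (kletter f) v"
    by (simp only: inv_eval_kwire[OF uv(1)] inv_eval_kwire[OF uv(2)] kwire_inject)
qed

lemma iw_inv_append: "iw_inv (u @ v) = iw_inv v @ iw_inv u"
  by (simp add: iw_inv_def)

lemma iw_inv_iw_inv [simp]: "iw_inv (iw_inv u) = u"
proof -
  have "map ((\<lambda>(x, b). (x, \<not> b)) \<circ> (\<lambda>(x, b). (x, \<not> b))) u = u"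
    by (rule map_idI) auto
  then show ?thesis by (simp add: iw_inv_def rev_map)
qed

lemma keval_iw_inv: "keval (kletter f) (iw_inv u) = kstar (keval (kletter f) u)"
proof (induction u)
  case (Cons a u)
  have "iw_inv (a # u) = iw_inv u @ [(fst a, \<not> snd a)]" by (simp add: iw_inv_def split_beta)
  moreover have "kletter f (fst a, \<not> snd a) = kstar (kletter f a)" by (simp add: kletter_def)
  ultimately show ?case using Cons by (simp add: kstar_kmul)
qed (simp add: iw_inv_def)

lemma ikid_iw_inv: "ikid u v \<Longrightarrow> ikid (iw_inv u) (iw_inv v)"
  by (simp add: ikid_def keval_iw_inv)

lemma ikid_sym: "ikid u v \<Longrightarrow> ikid v u"
  by (simp add: ikid_def)

text \<open>Sending \<open>x\<close> to the idempotent \<open>h\<^sub>2h\<^sub>1\<close> or to its reflection detects the polarities of \<open>x\<close>: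
  a product of both creates a loop.\<close>

lemma ikid_set_subset:
  assumes "ikid u v"
  shows "set v \<subseteq> set u"
proof
  fix a assume "a \<in> set v"
  show "a \<in> set u"
  proof (rule ccontr)
    assume a: "a \<notin> set u"
    define p where "p = snd a"
    define f :: "nat \<Rightarrow> kmodel" where "f y = (if y = fst a then (Some (False, True), 0) else (None, 0))" for y
    have f: "kletter f z = (if z = a then (Some (p, \<not> p), 0) else if fst z = fst a then (Some (\<not> p, p), 0) else (None, 0))" for z
      by (cases z; cases a) (auto simp: kletter_def f_def p_def)
    \<comment> \<open>\<open>A\<close> contains the values of words avoiding \<open>a\<close>. The
      letter \<open>a\<close> has the wrong upper arc, and no letter multiplied from the left leads
      back into \<open>A\<close>.\<close>
    define A :: "kmodel set" where "A = {(None, 0), (Some (\<not> p, p), 0)}"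
    have u: "keval (kletter f) w \<in> A" if "a \<notin> set w" for w
      using that by (induction w) (auto simp: f A_def)
    have v: "a \<notin> set w" if "keval (kletter f) w \<in> A" for w
      using that
    proof (induction w)
      case (Cons z w)
      obtain x d where k: "keval (kletter f) w = (x, d)" by force
      have "kmul (kletter f z) (x, d) \<in> A" using Cons.prems k by simp
      then have "z \<noteq> a \<and> (x, d) \<in> A"
        unfolding f[of z] by (cases x) (auto simp: A_def split: if_splits)
      then show ?case using Cons.IH k by auto
    qed simp
    show False using u[OF a] v[of v] assms \<open>a \<in> set v\<close> by (simp add: ikid_def)
  qed
qed

text \<open>With one polarity per variable, the letters of \<open>u\<close> take independent values:
  a starred letter gets its value by assigning the reflection to its variable.\<close>

lemma ikid_kid:
  assumes "ikid u v" and cons: "\<And>x. \<not> ((x, True) \<in> set u \<and> (x, False) \<in> set u)"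
  shows "kid u v"
  unfolding kid_def
proof
  fix g
  define f where "f x = (if (x, True) \<in> set u then kstar (g (x, True)) else g (x, False))" for x
  have *: "kletter f a = g a" if "a \<in> set u" for a
  proof -
    obtain x b where a: "a = (x, b)" by (cases a)
    show ?thesis using that cons[of x] by (cases b) (auto simp: a kletter_def f_def)
  qed
  have "keval g u = keval (kletter f) u" using * by (intro keval_cong) simp
  also have "\<dots> = keval (kletter f) v" using assms(1) by (simp add: ikid_def)
  also have "\<dots> = keval g v" using * ikid_set_subset[OF assms(1)] by (intro keval_cong) auto
  finally show "keval g u = keval g v" .
qed

definition isub :: "(nat \<Rightarrow> iword) \<Rightarrow> nat \<times> bool \<Rightarrow> iword" where
  "isub th a = (if snd a then iw_inv (th (fst a)) else th (fst a))"

lemma inv_subst_isub: "inv_subst th u = concat (map (isub th) u)"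
proof -
  have "isub th = (\<lambda>(x, b). if b then iw_inv (th x) else th x)" by (auto simp: isub_def)
  then show ?thesis by (simp add: inv_subst_def)
qed

lemma pos_map_fst: "\<forall>a\<in>set X. \<not> snd a \<Longrightarrow> pos (map fst X) = X"
  by (induction X) (auto simp: pos_def)

text \<open>If \<open>u\<close> had both \<open>x\<close> and its star, the nonempty
  \<open>th x\<close> would put a starred letter into a positive word. So \<open>u\<close> can be
  treated as a plain word over its letters, and \<open>v\<close> has no others.\<close>

lemma ikid_zw:
  assumes "ikid u v" "card (set u) + 4 \<le> r" and th: "\<forall>x. th x \<noteq> []"
    and eq: "s @ inv_subst th u @ t = pos (zw r m)"
  shows "s @ inv_subst th v @ t = pos (zw r m)"
proof -
  have p: "\<forall>a\<in>set (s @ inv_subst th u @ t). \<not> snd a"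
    unfolding eq by (auto simp: pos_def)
  then have pu: "\<not> snd b" if "a \<in> set u" "b \<in> set (isub th a)" for a b
    using that by (auto simp: inv_subst_isub)
  have "kid u v"
  proof (rule ikid_kid[OF assms(1)])
    show "\<not> ((x, True) \<in> set u \<and> (x, False) \<in> set u)" for x
    proof
      assume x: "(x, True) \<in> set u \<and> (x, False) \<in> set u"
      obtain b where b: "b \<in> set (th x)" using th by (metis list.set_intros(1) neq_Nil_conv)
      then have "(fst b, \<not> snd b) \<in> set (iw_inv (th x))" by (force simp: iw_inv_def)
      then show False using pu[of "(x, True)" "(fst b, \<not> snd b)"] pu[of "(x, False)" b] x b by (simp add: isub_def)
    qed
  qed
  moreover have "map fst s @ concat (map (\<lambda>a. map fst (isub th a)) u) @ map fst t = zw r m"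
    using arg_cong[OF eq, of "map fst"] by (simp add: inv_subst_isub map_concat comp_def pos_def)
  ultimately have "map fst s @ concat (map (\<lambda>a. map fst (isub th a)) v) @ map fst t = zw r m"
    using zw_isolated_context assms(2) by blast
  then have "map fst (s @ inv_subst th v @ t) = zw r m"
    by (simp add: inv_subst_isub map_concat comp_def)
  moreover have "set (inv_subst th v) \<subseteq> set (inv_subst th u)"
    using ikid_set_subset[OF assms(1)] by (auto simp: inv_subst_isub)
  then have "\<forall>a\<in>set (s @ inv_subst th v @ t). \<not> snd a"
    using p by (simp only: set_append) blast
  ultimately show ?thesis using pos_map_fst by metis
qed

lemma inv_subst_append: "inv_subst th (u @ v) = inv_subst th u @ inv_subst th v"
  by (simp add: inv_subst_def)

lemma inv_subst_iw_inv: "inv_subst th (iw_inv u) = iw_inv (inv_subst th u)"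
proof (induction u)
  case (Cons a u)
  have "iw_inv (a # u) = iw_inv u @ [(fst a, \<not> snd a)]" by (simp add: iw_inv_def split_beta)
  then show ?case using Cons by (simp add: inv_subst_isub isub_def iw_inv_append)
qed (simp add: iw_inv_def inv_subst_def)

lemma inv_subst_inv_subst: "inv_subst th (inv_subst th' u) = inv_subst (\<lambda>x. inv_subst th (th' x)) u"
proof (induction u)
  case (Cons a u)
  have "inv_subst th (isub th' a) = isub (\<lambda>x. inv_subst th (th' x)) a"
    by (simp add: isub_def inv_subst_iw_inv)
  then show ?case using Cons by (simp add: inv_subst_isub[of _ "a # u"] inv_subst_append) (simp add: inv_subst_isub)
qed (simp add: inv_subst_def)

lemma inv_subst_eq_Nil: "\<forall>x. th x \<noteq> [] \<Longrightarrow> inv_subst th u = [] \<longleftrightarrow> u = []"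
  by (cases u) (auto simp: inv_subst_isub isub_def iw_inv_def)

lemma card_set_iw_inv: "card (set (iw_inv u)) = card (set u)"
proof -
  have "set (iw_inv u) = (\<lambda>(x, b). (x, \<not> b)) ` set u" by (simp add: iw_inv_def)
  moreover have "inj (\<lambda>(x :: nat, b). (x, \<not> b))" by (auto simp: inj_def)
  ultimately show ?thesis by (metis card_image inj_on_subset subset_UNIV)
qed

text \<open>The conjunct on inverted words makes the claim invariant under the rule
  \<open>inv\<close>.\<close>

lemma inv_deriv_zw:
  assumes S: "S \<subseteq> inv_Id (kauff 3) (wmult 3) wstar" and r: "\<forall>(u, v)\<in>S. card (set u) + 4 \<le> r \<and> card (set v) + 4 \<le> r"
    and "inv_deriv S (u, v)" "\<forall>x. th x \<noteq> []"
  shows "(s @ inv_subst th u @ t = pos (zw r m) \<longleftrightarrow> s @ inv_subst th v @ t = pos (zw r m)) \<and>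
    (s @ inv_subst th (iw_inv u) @ t = pos (zw r m) \<longleftrightarrow> s @ inv_subst th (iw_inv v) @ t = pos (zw r m))"
  using assms(3,4)
proof (induction "(u, v)" arbitrary: u v s t th rule: inv_deriv.induct)
  case (ax u v)
  then have *: "ikid u v" "ikid v u" using S by (auto intro: inv_Id_kauff_ikid ikid_sym)
  then have "ikid (iw_inv u) (iw_inv v)" "ikid (iw_inv v) (iw_inv u)" by (auto intro: ikid_iw_inv)
  moreover have "card (set u) + 4 \<le> r" "card (set v) + 4 \<le> r"
    using r ax by auto
  moreover from this have "card (set (iw_inv u)) + 4 \<le> r" "card (set (iw_inv v)) + 4 \<le> r"
    by (simp_all add: card_set_iw_inv)
  ultimately show ?case using ikid_zw[OF _ _ ax(2)] * by meson
next
  case (trans u v w)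
  show ?case using trans(2)[OF trans(5)] trans(4)[OF trans(5)] by simp
next
  case (subst u v th')
  have "\<forall>x. inv_subst th (th' x) \<noteq> []" using subst by (simp add: inv_subst_eq_Nil)
  note subst(2)[OF this]
  then show ?case by (simp add: inv_subst_inv_subst flip: inv_subst_iw_inv)
next
  case (left u v w)
  then show ?case using left(2)[OF left(4), of "s @ inv_subst th w" t] left(2)[OF left(4), of s "inv_subst th (iw_inv w) @ t"]
    by (simp add: inv_subst_append iw_inv_append)
next
  case (right u v w)
  then show ?case using right(2)[OF right(4), of s "inv_subst th w @ t"] right(2)[OF right(4), of "s @ inv_subst th (iw_inv w)" t]
    by (simp add: inv_subst_append iw_inv_append)
qed auto

lemma inv_not_finitely_based:
  assumes W: "inv_Id (wire_set n) (wmult n) wstar \<subseteq> T" and K: "T \<subseteq> inv_Id (kauff 3) (wmult 3) wstar"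
  shows "\<not> inv_finitely_based T"
proof
  assume "inv_finitely_based T"
  then obtain S where S: "finite S" "{p. inv_deriv S p} = T" by (auto simp: inv_finitely_based_def)
  obtain m w where w: "w \<noteq> zw (var_bound S) m" "w \<noteq> []" "zw (var_bound S) m \<noteq> []"
    "\<And>f. (\<And>x. f x \<in> wire_set n) \<Longrightarrow> sg_eval (wmult n) f (zw (var_bound S) m) = sg_eval (wmult n) f w"
    using zw_swap[OF var_bound(2)[OF S(1)], of n] by metis
  let ?z = "pos (zw (var_bound S) m)"
  \<comment> \<open>On positive words evaluation ignores the involution, so the plain swap identity
    carries over.\<close>
  have "(?z, pos w) \<in> inv_Id (wire_set n) (wmult n) wstar"
    using w by (auto simp: inv_Id_def inv_ids_def inv_eval_pos) (simp_all add: pos_def)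
  then have "inv_deriv S (?z, pos w)" using W S by auto
  moreover have "S \<subseteq> inv_Id (kauff 3) (wmult 3) wstar" using K S inv_deriv.ax by blast
  moreover have "inv_subst (\<lambda>x. [(x, False)]) (pos u) = pos u" for u
    by (induction u) (simp_all add: pos_def inv_subst_def)
  ultimately have "pos w = ?z"
    using inv_deriv_zw[of S "var_bound S" ?z "pos w" "\<lambda>x. [(x, False)]" "[]" "[]" m] var_bound(1)[OF S(1)]
    by simp
  then have "w = zw (var_bound S) m"
    unfolding pos_def by (rule map_injective) (auto simp: inj_def)
  then show False using w by simp
qed

theorem theorem2:
  fixes n :: nat
  assumes "n \<ge> 3"
  shows "(\<forall>T. sg_eq_theory T \<and> sg_Id (wire_set n) (wmult n) \<subseteq> T \<and> T \<subseteq> sg_Id (kauff 3) (wmult 3)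
            \<longrightarrow> \<not> sg_finitely_based T)
       \<and> (\<forall>T. inv_eq_theory T \<and> inv_Id (wire_set n) (wmult n) wstar \<subseteq> T \<and> T \<subseteq> inv_Id (kauff 3) (wmult 3) wstar
            \<longrightarrow> \<not> inv_finitely_based T)"
  using sg_not_finitely_based inv_not_finitely_based by blast

end
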